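(* Let $d=1$ and let $\nu=m_F$ be a Lebesgue–Stieltjes measure in $\mathcal{M}(\Phi)$. If $F$ is differentiable at $x_0\in\mathbb{R}$, then $$\lim_{|x-x_0|<\alpha t\to0}\mathbb{P}_t\nu(x)=F'(x_0),\qquad\forall\,\alpha>0.$$
   Context: A locally finite complex measure in $\mathbb{R}$ is $\nu=\nu_1+i\nu_2$ where $\nu_1,\nu_2$ are signed Borel measures which are finite on compact sets; $|\nu|$ denotes its total variation. Such a measure is written as a Lebesgue–Stieltjes measure $\nu=m_F$, where $F:\mathbb{R}\to\mathbb{C}$ is a right-continuous function of locally bounded variation with $\nu((a,b])=F(b)-F(a)$ for all $a<b$. Poisson–Hermite semigroup ($d=1$): let $L=-\frac{d^2}{dx^2}+x^2$ be the Hermite operator in $\mathbb{R}$ and $\mathbb{P}_t=e^{-t\sqrt L}=\frac{t}{\sqrt{4\pi}}\int_0^\infty e^{-t^2/(4\tau)}e^{-\tau L}\frac{d\tau}{\tau^{3/2}}$, $t>0$. Its integral kernel is $$\mathbb{P}_t(x,y)=c_1\,t\int_0^1\frac{e^{-t^2/\kappa(s)}(1-s^2)^{-\frac12}e^{-\frac14\left(\frac{|x-y|^2}{s}+s|x+y|^2\right)}}{s^{1/2}\,\kappa(s)^{3/2}}\,ds,\qquad \kappa(s)=2\ln\frac{1+s}{1-s},$$ where $c_1=8(4\pi)^{-1}=2/\pi$. Let $\Phi(y)=\dfrac{e^{-|y|^2/2}}{(1+|y|)^{1/2}[\log(e+|y|)]^{3/2}}$, and let $\mathcal{M}(\Phi)$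 be the set of locally finite complex measures $\nu$ in $\mathbb{R}$ with $\int_{\mathbb{R}}\Phi\,d|\nu|<\infty$. For $\nu\in\mathcal{M}(\Phi)$ set $\mathbb{P}_t\nu(x)=\int_{\mathbb{R}}\mathbb{P}_t(x,y)\,d\nu(y)$, which converges absolutely for all $t>0$, $x\in\mathbb{R}$. The notation $\lim_{|x-x_0|<\alpha t\to0}$ means the limit as $(t,x)\to(0,x_0)$ over points $(t,x)\in(0,\infty)\times\mathbb{R}$ with $|x-x_0|<\alpha t$. *)

theory Defs
  imports "HOL-Analysis.Analysis"
begin

section \<open>Locally finite complex measures on the line\<close>

(* A locally finite signed or complex measure need not have a meaningful value on unbounded sets
   (consider x dx), so it is a countably additive set function on the bounded Borel sets.  Its values
   elsewhere are irrelevant and none of the notions below look at them. *)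
definition locally_finite_signed_measure :: "(real set \<Rightarrow> real) \<Rightarrow> bool" where
  "locally_finite_signed_measure \<mu> \<longleftrightarrow>
     (\<forall>A :: nat \<Rightarrow> real set. (\<forall>n. A n \<in> sets borel) \<longrightarrow> disjoint_family A \<longrightarrow> bounded (\<Union>n. A n) \<longrightarrow>
        (\<lambda>n. \<mu> (A n)) sums \<mu> (\<Union>n. A n))"

definition locally_finite_complex_measure :: "(real set \<Rightarrow> complex) \<Rightarrow> bool" where
  "locally_finite_complex_measure \<nu> \<longleftrightarrow>
     locally_finite_signed_measure (\<lambda>A. Re (\<nu> A)) \<and> locally_finite_signed_measure (\<lambda>A. Im (\<nu> A))"

(* The set functions below are countably additive whenever the argument is a locally finite
   measure, so that measure_of does not fall back to the zero measure. *)
definition total_variation :: "(real set \<Rightarrow> complex) \<Rightarrow> real measure" where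
  "total_variation \<nu> = measure_of UNIV (sets borel)
     (\<lambda>A. SUP E \<in> {E :: nat \<Rightarrow> real set. (\<forall>n. E n \<in> sets borel \<and> bounded (E n)) \<and>
                     disjoint_family E \<and> (\<Union>n. E n) = A}.
            (\<Sum>n. ennreal (cmod (\<nu> (E n)))))"

(* The positive part of the Jordan decomposition; the negative part of \<mu> is the positive part
   of -\<mu>. *)
definition positive_variation :: "(real set \<Rightarrow> real) \<Rightarrow> real measure" where
  "positive_variation \<mu> = measure_of UNIV (sets borel)
     (\<lambda>A. SUP B \<in> {B \<in> sets borel. bounded B \<and> B \<subseteq> A}. ennreal (\<mu> B))"

definition signed_integral :: "(real set \<Rightarrow> real) \<Rightarrow> (real \<Rightarrow> complex) \<Rightarrow> complex" where
  "signed_integral \<mu> f =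
     (\<integral>y. f y \<partial>positive_variation \<mu>) - (\<integral>y. f y \<partial>positive_variation (\<lambda>A. - \<mu> A))"

definition complex_measure_integral :: "(real set \<Rightarrow> complex) \<Rightarrow> (real \<Rightarrow> complex) \<Rightarrow> complex" where
  "complex_measure_integral \<nu> f =
     signed_integral (\<lambda>A. Re (\<nu> A)) f + \<i> * signed_integral (\<lambda>A. Im (\<nu> A)) f"

definition locally_bounded_variation :: "(real \<Rightarrow> complex) \<Rightarrow> bool" where
  "locally_bounded_variation F \<longleftrightarrow>
     (\<forall>a b. \<exists>C. \<forall>n. \<forall>x :: nat \<Rightarrow> real. mono x \<longrightarrow> range x \<subseteq> {a..b} \<longrightarrow>
        (\<Sum>i<n. cmod (F (x (Suc i)) - F (x i))) \<le> C)"

(* \<nu> = m_F; the half-open intervals determine \<nu> on all bounded Borel sets. *)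
definition is_lebesgue_stieltjes :: "(real set \<Rightarrow> complex) \<Rightarrow> (real \<Rightarrow> complex) \<Rightarrow> bool" where
  "is_lebesgue_stieltjes \<nu> F \<longleftrightarrow>
     locally_finite_complex_measure \<nu> \<and>
     (\<forall>x. continuous (at_right x) F) \<and> locally_bounded_variation F \<and>
     (\<forall>a b. a < b \<longrightarrow> \<nu> {a<..b} = F b - F a)"

definition weighted_measures :: "(real \<Rightarrow> real) \<Rightarrow> (real set \<Rightarrow> complex) set" where
  "weighted_measures w =
     {\<nu>. locally_finite_complex_measure \<nu> \<and> (\<integral>\<^sup>+y. ennreal (w y) \<partial>total_variation \<nu>) < \<infinity>}"

section \<open>The Poisson--Hermite semigroup\<close>

definition hermite_weight :: "real \<Rightarrow> real" where
  "hermite_weight y =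
     exp (- (\<bar>y\<bar>\<^sup>2 / 2)) / ((1 + \<bar>y\<bar>) powr (1/2) * (ln (exp 1 + \<bar>y\<bar>)) powr (3/2))"

definition kappa :: "real \<Rightarrow> real" where
  "kappa s = 2 * ln ((1 + s) / (1 - s))"

(* Mehler's formula for the heat kernel of L = -d^2/dx^2 + x^2, subordinated, with the
   substitution s = tanh \<tau> (so that kappa s = 4 \<tau>). *)
definition poisson_hermite_kernel :: "real \<Rightarrow> real \<Rightarrow> real \<Rightarrow> real" where
  "poisson_hermite_kernel t x y = (2 / pi) * t *
     (LINT s:{0<..<1}|lborel.
        exp (- (t\<^sup>2 / kappa s)) * (1 - s\<^sup>2) powr (-1/2) *
          exp (- (1/4) * (\<bar>x - y\<bar>\<^sup>2 / s + s * \<bar>x + y\<bar>\<^sup>2))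
        / (s powr (1/2) * kappa s powr (3/2)))"

definition poisson_hermite :: "real \<Rightarrow> (real set \<Rightarrow> complex) \<Rightarrow> real \<Rightarrow> complex" where
  "poisson_hermite t \<nu> x =
     complex_measure_integral \<nu> (\<lambda>y. complex_of_real (poisson_hermite_kernel t x y))"

end

theory Submission
  imports Defs
begin

text \<open>
  Write \<open>p t r = t / (pi * (t\<^sup>2 + r\<^sup>2))\<close> for the classical Poisson kernel of the half-plane.  The
  theorem is Fatou's theorem on nontangential limits of Poisson integrals, carried over to the
  Hermite setting by a pointwise comparison of kernels.

  In the subordination formula \<open>kappa s\<close> behaves like \<open>4 * s\<close> for small \<open>s\<close>.  If the integrand is
  replaced by its leading term at \<open>s = 0\<close> and the integration is extended to all \<open>s > 0\<close>, the
  formula yields exactly \<open>p t (x - y)\<close>.  The relative error of the integrand is of order \<open>s\<close>, and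
  integration turns it into an absolute error of at most a constant times \<open>sqrt t\<close>, uniformly for
  \<open>t \<le> 1\<close> and bounded \<open>x\<close> and \<open>y\<close>.  For large \<open>y\<close> and bounded \<open>x\<close> the Mehler exponent exceeds \<open>y\<^sup>2 / 2\<close>
  by at least a multiple of \<open>((1 - s) * y)\<^sup>2\<close>, up to a constant for \<open>s > 1/2\<close>, so the relevant range is
  \<open>1 - s\<close> of order \<open>1 / \<bar>y\<bar>\<close>; there \<open>kappa s\<close> is of order \<open>ln \<bar>y\<bar>\<close>, and the integral is bounded by a
  constant times \<open>hermite_weight y\<close>, with the prefactor \<open>t\<close> of the kernel left over.
  Together (\<open>poisson_hermite_kernel_approx\<close>), for \<open>t \<le> 1\<close> and bounded \<open>x\<close> the Poisson--Hermite kernel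
  differs from \<open>p\<close>, cut off to a large interval, by at most \<open>C * sqrt t * hermite_weight y\<close>.  As the weight is integrable with
  respect to \<open>\<bar>\<nu>\<bar>\<close>, the problem is reduced to \<open>p\<close> on a bounded interval.

  For \<open>p\<close> (\<open>nontangential_limit_poisson_integral\<close>), integration by parts moves the derivative from the
  measure to the kernel.  The affine part of the distribution function at \<open>x\<^sub>0\<close> is integrated
  explicitly and gives the limit.  The remainder is \<open>\<bar>z - x\<^sub>0\<bar>\<close> times a quantity that is small near
  \<open>x\<^sub>0\<close>, and in the cone \<open>\<bar>x - x\<^sub>0\<bar> < \<alpha> * t\<close> the factor \<open>\<bar>z - x\<^sub>0\<bar>\<close> turns the derivative of \<open>p\<close> into
  something dominated by \<open>p\<close> itself.

  The passage from \<open>\<nu>\<close> to positive measures uses the Jordan decompositions of its real and imaginary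
  parts.  The four resulting measures are dominated by the total variation, so that the weight
  is integrable with respect to each of them; in particular they are finite on bounded sets.
\<close>

section \<open>Variations of locally finite measures\<close>

text \<open>
  A set function defined as a supremum is easily seen to be superadditive (combine competitors) and
  countably subadditive (cut a competitor into pieces).  This lemma turns the two halves into
  countable additivity; both variations below are treated in this way.
\<close>
lemma countably_additive_of_superadditive:
  fixes f :: "'a set \<Rightarrow> ennreal"
  assumes "sigma_algebra \<Omega> M"
    and super: "\<And>A B. A \<in> M \<Longrightarrow> B \<in> M \<Longrightarrow> A \<inter> B = {} \<Longrightarrow> f A + f B \<le> f (A \<union> B)"
    and sub: "\<And>A. range A \<subseteq> M \<Longrightarrow> disjoint_family A \<Longrightarrow> f (\<Union>n. A n) \<le> (\<Sum>n. f (A n))"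
  shows "countably_additive M f"
proof (unfold countably_additive_def, intro allI impI)
  interpret sigma_algebra \<Omega> M by fact
  fix A :: "nat \<Rightarrow> 'a set"
  assume A: "range A \<subseteq> M" "disjoint_family A" "(\<Union>n. A n) \<in> M"
  have mono: "f B \<le> f C" if "B \<in> M" "C \<in> M" "B \<subseteq> C" for B C
  proof -
    have "f B \<le> f B + f (C - B)" by simp
    also have "\<dots> \<le> f (B \<union> (C - B))" using that by (intro super) auto
    finally show ?thesis using that by (simp add: Un_absorb1)
  qed
  have partial: "(\<Sum>i<n. f (A i)) \<le> f (\<Union>i<n. A i)" for n
  proof (induction n)
    case (Suc n)
    have "(\<Union>i<n. A i) \<inter> A n = {}"
      using A(2) by (auto simp: disjoint_family_on_def) (metis IntI empty_iff less_irrefl)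
    moreover have "(\<Union>i<n. A i) \<in> M" "A n \<in> M" using A(1) by auto
    ultimately have "f (\<Union>i<n. A i) + f (A n) \<le> f ((\<Union>i<n. A i) \<union> A n)" by (intro super)
    also have "(\<Union>i<n. A i) \<union> A n = (\<Union>i<Suc n. A i)" by (auto simp: less_Suc_eq)
    finally show ?case using Suc.IH by (simp add: order_trans[OF add_right_mono])
  qed simp
  have "(\<Sum>i<n. f (A i)) \<le> f (\<Union>i. A i)" for n
    using partial[of n] mono[of "\<Union>i<n. A i" "\<Union>i. A i"] A by (force intro: order_trans)
  then have "(\<Sum>n. f (A n)) \<le> f (\<Union>n. A n)"
    by (intro suminf_le_const) (auto intro: summableI)
  with sub[OF A(1,2)] show "(\<Sum>n. f (A n)) = f (\<Union>n. A n)" by (rule antisym[rotated])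
qed

lemma locally_finite_signed_measure_empty:
  assumes "locally_finite_signed_measure \<mu>"
  shows "\<mu> {} = 0"
proof -
  have "(\<lambda>n::nat. \<mu> {}) sums \<mu> (\<Union>n::nat. {})"
    using assms[unfolded locally_finite_signed_measure_def, rule_format, of "\<lambda>_. {}"]
    by (simp add: disjoint_family_on_def)
  then have "summable (\<lambda>n::nat. \<mu> {})" by (rule sums_summable)
  then show ?thesis by (simp add: summable_const_iff)
qed

lemma locally_finite_signed_measure_Un:
  assumes \<mu>: "locally_finite_signed_measure \<mu>"
    and "A \<in> sets borel" "B \<in> sets borel" "bounded A" "bounded B" "A \<inter> B = {}"
  shows "\<mu> (A \<union> B) = \<mu> A + \<mu> B"
proof -
  define C where "C n = (if n = 0 then A else if n = Suc 0 then B else {})" for n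
  have U: "(\<Union>n. C n) = A \<union> B"
    unfolding C_def by (auto split: if_splits) 
  have "(\<lambda>n. \<mu> (C n)) sums \<mu> (\<Union>n. C n)"
    using assms U
    by (intro \<mu>[unfolded locally_finite_signed_measure_def, rule_format])
       (auto simp: C_def disjoint_family_on_def)
  moreover have "(\<lambda>n. \<mu> (C n)) sums (\<Sum>n\<in>{0, Suc 0}. \<mu> (C n))"
    using locally_finite_signed_measure_empty[OF \<mu>] by (intro sums_finite) (auto simp: C_def)
  ultimately have "\<mu> (\<Union>n. C n) = (\<Sum>n\<in>{0, Suc 0}. \<mu> (C n))" by (rule sums_unique2)
  then show ?thesis unfolding U by (simp add: C_def)
qed

lemma locally_finite_signed_measure_uminus:
  assumes "locally_finite_signed_measure \<mu>"
  shows "locally_finite_signed_measure (\<lambda>A. - \<mu> A)"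
  using assms unfolding locally_finite_signed_measure_def by (simp add: sums_minus)

lemma ennreal_suminf_ge_norm:
  fixes f :: "nat \<Rightarrow> 'a :: real_normed_vector"
  assumes "f sums s"
  shows "ennreal (norm s) \<le> (\<Sum>n. ennreal (norm (f n)))"
proof (rule LIMSEQ_le_const2)
  show "(\<lambda>n. ennreal (norm (\<Sum>i<n. f i))) \<longlonglongrightarrow> ennreal (norm s)"
    using assms unfolding sums_def by (intro tendsto_ennrealI tendsto_norm)
  show "\<exists>N. \<forall>n\<ge>N. ennreal (norm (\<Sum>i<n. f i)) \<le> (\<Sum>n. ennreal (norm (f n)))"
  proof (intro exI[of _ 0] allI impI)
    fix n
    have "ennreal (norm (\<Sum>i<n. f i)) \<le> ennreal (\<Sum>i<n. norm (f i))"
      by (intro ennreal_leI norm_sum)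
    also have "\<dots> = (\<Sum>i<n. ennreal (norm (f i)))" by (simp add: sum_ennreal)
    also have "\<dots> \<le> (\<Sum>n. ennreal (norm (f n)))" by (intro sum_le_suminf summableI) auto
    finally show "ennreal (norm (\<Sum>i<n. f i)) \<le> \<dots>" .
  qed
qed

lemma ennreal_suminf_ge:
  fixes f :: "nat \<Rightarrow> real"
  assumes "f sums s"
  shows "ennreal s \<le> (\<Sum>n. ennreal (f n))"
proof (rule LIMSEQ_le_const2)
  show "(\<lambda>n. ennreal (\<Sum>i<n. f i)) \<longlonglongrightarrow> ennreal s"
    using assms unfolding sums_def by (intro tendsto_ennrealI)
  show "\<exists>N. \<forall>n\<ge>N. ennreal (\<Sum>i<n. f i) \<le> (\<Sum>n. ennreal (f n))"
  proof (intro exI[of _ 0] allI impI)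
    fix n
    have "ennreal (\<Sum>i<n. f i) \<le> ennreal (\<Sum>i<n. max 0 (f i))"
      by (intro ennreal_leI sum_mono) auto
    also have "\<dots> = (\<Sum>i<n. ennreal (max 0 (f i)))" by (simp add: sum_ennreal)
    also have "\<dots> = (\<Sum>i<n. ennreal (f i))" by (intro sum.cong) (auto simp: max_def ennreal_neg)
    also have "\<dots> \<le> (\<Sum>n. ennreal (f n))" by (intro sum_le_suminf summableI) auto
    finally show "ennreal (\<Sum>i<n. f i) \<le> \<dots>" .
  qed
qed

lemma SUP_plus_SUP_le:
  fixes f :: "'a \<Rightarrow> ennreal"
  assumes "I \<noteq> {}" "J \<noteq> {}" "\<And>i j. i \<in> I \<Longrightarrow> j \<in> J \<Longrightarrow> f i + g j \<le> x"
  shows "(SUP i\<in>I. f i) + (SUP j\<in>J. g j) \<le> x"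
proof -
  have "(SUP i\<in>I. f i) + (SUP j\<in>J. g j) = (SUP i\<in>I. f i + (SUP j\<in>J. g j))"
    using assms(1) by (rule ennreal_SUP_add_left[symmetric])
  also have "\<dots> = (SUP i\<in>I. SUP j\<in>J. f i + g j)"
    using assms(2) by (simp add: ennreal_SUP_add_right)
  also have "\<dots> \<le> x" by (intro SUP_least assms(3))
  finally show ?thesis .
qed

text \<open>
  Negative values of \<open>\<mu>\<close> are truncated to \<open>0\<close> by \<open>ennreal\<close>, which is why superadditivity needs the
  case distinction on the signs: a competitor of negative measure is dropped.
\<close>
lemma emeasure_positive_variation:
  assumes \<mu>: "locally_finite_signed_measure \<mu>" and "A \<in> sets borel"
  shows "emeasure (positive_variation \<mu>) A =
           (SUP B \<in> {B \<in> sets borel. bounded B \<and> B \<subseteq> A}. ennreal (\<mu> B))"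
  unfolding positive_variation_def
proof (rule emeasure_measure_of_sigma)
  let ?P = "\<lambda>A. SUP B \<in> {B \<in> sets borel. bounded B \<and> B \<subseteq> A}. ennreal (\<mu> B)"
  show "sigma_algebra UNIV (sets (borel :: real measure))"
    using sets.sigma_algebra_axioms[of borel] by simp
  then show "countably_additive (sets borel) ?P"
  proof (rule countably_additive_of_superadditive)
    fix A B :: "real set" assume AB: "A \<in> sets borel" "B \<in> sets borel" "A \<inter> B = {}"
    show "?P A + ?P B \<le> ?P (A \<union> B)"
    proof (rule SUP_plus_SUP_le)
      fix C D assume C: "C \<in> {B \<in> sets borel. bounded B \<and> B \<subseteq> A}"
        and D: "D \<in> {C \<in> sets borel. bounded C \<and> C \<subseteq> B}"
      have up: "ennreal (\<mu> E) \<le> ?P (A \<union> B)" if "E \<in> sets borel" "bounded E" "E \<subseteq> A \<union> B" for E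
        using that by (intro SUP_upper) auto
      consider "\<mu> C \<le> 0" | "\<mu> D \<le> 0" | "\<mu> C \<ge> 0" "\<mu> D \<ge> 0" by linarith
      then show "ennreal (\<mu> C) + ennreal (\<mu> D) \<le> ?P (A \<union> B)"
      proof cases
        case 1 then show ?thesis using up[of D] D by (auto simp: ennreal_neg)
      next
        case 2 then show ?thesis using up[of C] C by (auto simp: ennreal_neg)
      next
        case 3
        have "\<mu> (C \<union> D) = \<mu> C + \<mu> D"
          using C D AB by (intro locally_finite_signed_measure_Un[OF \<mu>]) auto
        with 3 show ?thesis using up[of "C \<union> D"] C D by (auto simp: ennreal_plus)
      qed
    qed (auto intro: exI[of _ "{}"])
  next
    fix A :: "nat \<Rightarrow> real set" assume A: "range A \<subseteq> sets borel" "disjoint_family A"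
    show "?P (\<Union>n. A n) \<le> (\<Sum>n. ?P (A n))"
    proof (rule SUP_least)
      fix B assume B: "B \<in> {B \<in> sets borel. bounded B \<and> B \<subseteq> (\<Union>n. A n)}"
      then have U: "(\<Union>n. B \<inter> A n) = B" by auto
      have "(\<lambda>n. \<mu> (B \<inter> A n)) sums \<mu> (\<Union>n. B \<inter> A n)"
        using A B U by (intro \<mu>[unfolded locally_finite_signed_measure_def, rule_format])
          (auto simp: disjoint_family_on_def)
      then have "ennreal (\<mu> B) \<le> (\<Sum>n. ennreal (\<mu> (B \<inter> A n)))"
        using U ennreal_suminf_ge by metis
      also have "\<dots> \<le> (\<Sum>n. ?P (A n))"
        using A B by (intro suminf_le summableI SUP_upper) (auto intro: bounded_Int)
      finally show "ennreal (\<mu> B) \<le> \<dots>" .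
    qed
  qed
  show "positive (sets borel) ?P"
    using locally_finite_signed_measure_empty[OF \<mu>]
    by (auto simp: positive_def SUP_eq_iff intro!: SUP_eq_const)
qed fact

lemma sets_positive_variation [measurable_cong, simp]: "sets (positive_variation \<mu>) = sets borel"
  unfolding positive_variation_def using sets.sigma_sets_eq[of borel] by (simp add: sets.space_closed)

lemma sets_total_variation [measurable_cong, simp]: "sets (total_variation \<nu>) = sets borel"
  unfolding total_variation_def using sets.sigma_sets_eq[of borel] by (simp add: sets.space_closed)

lemma locally_finite_complex_measure_sums:
  assumes "locally_finite_complex_measure \<nu>"
    and "\<And>n::nat. A n \<in> sets borel" "disjoint_family A" "bounded (\<Union>n. A n)"
  shows "(\<lambda>n. \<nu> (A n)) sums \<nu> (\<Union>n. A n)"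
  using assms unfolding locally_finite_complex_measure_def locally_finite_signed_measure_def
  by (auto simp: sums_complex_iff)

definition bounded_borel_partitions :: "real set \<Rightarrow> (nat \<Rightarrow> real set) set" where
  "bounded_borel_partitions A =
     {E. (\<forall>n. E n \<in> sets borel \<and> bounded (E n)) \<and> disjoint_family E \<and> (\<Union>n. E n) = A}"

lemma bounded_borel_partitions_nonempty:
  assumes "A \<in> sets borel"
  shows "bounded_borel_partitions A \<noteq> {}"
proof -
  let ?C = "\<lambda>n. A \<inter> cball 0 (real n)"
  have "(\<Union>n. ?C n) = A" by (auto simp: dist_norm intro: real_arch_simple)
  then have "(\<Union>n. disjointed ?C n) = A" unfolding UN_disjointed_eq .
  moreover have "disjointed ?C n \<in> sets borel" for n
    using assms by (auto simp: disjointed_def)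
  moreover have "bounded (disjointed ?C n)" for n
    by (rule bounded_subset[OF bounded_cball[of 0 "real n"]]) (auto simp: disjointed_def)
  ultimately have "disjointed ?C \<in> bounded_borel_partitions A"
    by (simp add: bounded_borel_partitions_def disjoint_family_disjointed)
  then show ?thesis by auto
qed

text \<open>
  Partitions of disjoint sets are interleaved along the even and the odd indices.
\<close>
lemma bounded_borel_partitions_Un:
  fixes f :: "real set \<Rightarrow> ennreal"
  assumes E: "E \<in> bounded_borel_partitions A" and E': "E' \<in> bounded_borel_partitions B"
    and AB: "A \<inter> B = {}"
  shows "\<exists>G \<in> bounded_borel_partitions (A \<union> B). (\<Sum>n. f (E n)) + (\<Sum>n. f (E' n)) \<le> (\<Sum>n. f (G n))"
proof
  define G where "G n = (if even n then E (n div 2) else E' (n div 2))" for n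
  have G0: "G (2 * n) = E n" "G (Suc (2 * n)) = E' n" for n by (auto simp: G_def)
  have U: "(\<Union>n. G n) = A \<union> B"
  proof
    show "(\<Union>n. G n) \<subseteq> A \<union> B"
      using E E' unfolding G_def bounded_borel_partitions_def by (auto split: if_splits)
    have "E n \<subseteq> (\<Union>n. G n)" "E' n \<subseteq> (\<Union>n. G n)" for n
      using G0[of n] by (metis UN_upper UNIV_I)+
    then show "A \<union> B \<subseteq> (\<Union>n. G n)"
      using E E' unfolding bounded_borel_partitions_def by blast
  qed
  have EE': "E i \<inter> E' j = {}" for i j
    using E E' AB unfolding bounded_borel_partitions_def by blast
  have "disjoint_family G"
    unfolding disjoint_family_on_def
  proof (intro ballI impI)
    fix m n :: nat assume "m \<noteq> n"
    show "G m \<inter> G n = {}"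
    proof (cases "even m = even n")
      case True
      with \<open>m \<noteq> n\<close> have "m div 2 \<noteq> n div 2"
        by (metis even_two_times_div_two odd_two_times_div_two_succ)
      with True E E' show ?thesis
        unfolding G_def bounded_borel_partitions_def disjoint_family_on_def by auto
    next
      case False
      then show ?thesis using EE' by (auto simp: G_def Int_commute)
    qed
  qed
  then show "G \<in> bounded_borel_partitions (A \<union> B)"
    using E E' U unfolding bounded_borel_partitions_def by (auto simp: G_def)
  have double: "(\<Sum>i<n. f (E i) + f (E' i)) = (\<Sum>i<2 * n. f (G i))" for n
    by (induction n) (simp_all add: G0 add.assoc)
  have "(\<Sum>n. f (E n)) + (\<Sum>n. f (E' n)) = (\<Sum>n. f (E n) + f (E' n))"
    by (intro suminf_add summableI)
  also have "\<dots> \<le> (\<Sum>n. f (G n))"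
    unfolding double by (intro suminf_le_const summableI) (simp add: double sum_le_suminf summableI)
  finally show "(\<Sum>n. f (E n)) + (\<Sum>n. f (E' n)) \<le> (\<Sum>n. f (G n))" .
qed

lemma emeasure_total_variation:
  assumes \<nu>: "locally_finite_complex_measure \<nu>" and "A \<in> sets borel"
  shows "emeasure (total_variation \<nu>) A =
           (SUP E \<in> bounded_borel_partitions A. \<Sum>n. ennreal (cmod (\<nu> (E n))))"
  unfolding total_variation_def bounded_borel_partitions_def[symmetric]
proof (rule emeasure_measure_of_sigma)
  let ?V = "\<lambda>A. SUP E \<in> bounded_borel_partitions A. \<Sum>n. ennreal (cmod (\<nu> (E n)))"
  show "sigma_algebra UNIV (sets (borel :: real measure))"
    using sets.sigma_algebra_axioms[of borel] by simp
  then show "countably_additive (sets borel) ?V"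
  proof (rule countably_additive_of_superadditive)
    fix A B :: "real set" assume AB: "A \<in> sets borel" "B \<in> sets borel" "A \<inter> B = {}"
    show "?V A + ?V B \<le> ?V (A \<union> B)"
    proof (intro SUP_plus_SUP_le bounded_borel_partitions_nonempty AB)
      fix E E' assume "E \<in> bounded_borel_partitions A" "E' \<in> bounded_borel_partitions B"
      from bounded_borel_partitions_Un[OF this AB(3), of "\<lambda>E. ennreal (cmod (\<nu> E))"]
      show "(\<Sum>n. ennreal (cmod (\<nu> (E n)))) + (\<Sum>n. ennreal (cmod (\<nu> (E' n)))) \<le> ?V (A \<union> B)"
        by (auto intro: SUP_upper2)
    qed
  next
    fix A :: "nat \<Rightarrow> real set" assume A: "range A \<subseteq> sets borel" "disjoint_family A"
    show "?V (\<Union>n. A n) \<le> (\<Sum>n. ?V (A n))"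
    proof (rule SUP_least)
      fix E assume E: "E \<in> bounded_borel_partitions (\<Union>n. A n)"
      have split: "ennreal (cmod (\<nu> (E n))) \<le> (\<Sum>k. ennreal (cmod (\<nu> (E n \<inter> A k))))" for n
      proof -
        have U: "(\<Union>k. E n \<inter> A k) = E n" using E by (auto simp: bounded_borel_partitions_def)
        have "(\<lambda>k. \<nu> (E n \<inter> A k)) sums \<nu> (\<Union>k. E n \<inter> A k)"
          using A E U by (intro locally_finite_complex_measure_sums[OF \<nu>])
            (auto simp: disjoint_family_on_def bounded_borel_partitions_def)
        then show ?thesis using U ennreal_suminf_ge_norm by metis
      qed
      have part: "(\<lambda>n. E n \<inter> A k) \<in> bounded_borel_partitions (A k)" for k
      proof -
        have "(\<Union>n. E n \<inter> A k) = A k" using E by (auto simp: bounded_borel_partitions_def)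
        moreover have "disjoint_family (\<lambda>n. E n \<inter> A k)"
          using E by (auto simp: bounded_borel_partitions_def disjoint_family_on_def)
        ultimately show ?thesis
          using A E by (auto simp: bounded_borel_partitions_def)
      qed
      have "(\<Sum>n. ennreal (cmod (\<nu> (E n)))) \<le> (\<Sum>n. \<Sum>k. ennreal (cmod (\<nu> (E n \<inter> A k))))"
        by (intro suminf_le split summableI)
      also have "\<dots> \<le> (\<Sum>k. ?V (A k))"
      proof (intro suminf_le_const summableI)
        fix N
        have "(\<Sum>n<N. \<Sum>k. ennreal (cmod (\<nu> (E n \<inter> A k)))) =
              (\<Sum>k. \<Sum>n<N. ennreal (cmod (\<nu> (E n \<inter> A k))))"
          by (intro suminf_sum[symmetric] summableI)
        also have "\<dots> \<le> (\<Sum>k. ?V (A k))"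
          by (intro suminf_le summableI SUP_upper2[OF part] sum_le_suminf) auto
        finally show "(\<Sum>n<N. \<Sum>k. ennreal (cmod (\<nu> (E n \<inter> A k)))) \<le> (\<Sum>k. ?V (A k))" .
      qed
      finally show "(\<Sum>n. ennreal (cmod (\<nu> (E n)))) \<le> (\<Sum>k. ?V (A k))" .
    qed
  qed
  have "\<nu> {} = 0"
    using \<nu> locally_finite_signed_measure_empty unfolding locally_finite_complex_measure_def
    by (auto simp: complex_eq_iff)
  then have "(\<Sum>n. ennreal (cmod (\<nu> (E n)))) = 0" if "E \<in> bounded_borel_partitions {}" for E
    using that by (auto simp: bounded_borel_partitions_def)
  then have "?V {} = (SUP E \<in> bounded_borel_partitions {}. 0)" by (intro SUP_cong refl)
  then show "positive (sets borel) ?V"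
    using bounded_borel_partitions_nonempty[of "{}"] by (simp add: positive_def)
qed fact

lemma cmod_le_total_variation:
  assumes \<nu>: "locally_finite_complex_measure \<nu>" and B: "B \<in> sets borel" "bounded B"
  shows "ennreal (cmod (\<nu> B)) \<le> emeasure (total_variation \<nu>) B"
proof -
  define E :: "nat \<Rightarrow> real set" where "E n = (if n = 0 then B else {})" for n
  have "E \<in> bounded_borel_partitions B"
    using B by (auto simp: bounded_borel_partitions_def disjoint_family_on_def E_def)
  moreover have "ennreal (cmod (\<nu> B)) \<le> (\<Sum>n. ennreal (cmod (\<nu> (E n))))"
  proof -
    have "ennreal (cmod (\<nu> B)) = (\<Sum>n\<in>{0}. ennreal (cmod (\<nu> (E n))))" by (simp add: E_def)
    also have "\<dots> \<le> (\<Sum>n. ennreal (cmod (\<nu> (E n))))"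
      by (intro sum_le_suminf summableI) auto
    finally show ?thesis .
  qed
  ultimately show ?thesis
    unfolding emeasure_total_variation[OF \<nu> B(1)] by (meson SUP_upper order_trans)
qed

text \<open>
  It transfers integrability of the weight from \<open>\<bar>\<nu>\<bar>\<close> to the positive and negative parts of the
  real and imaginary parts of \<open>\<nu>\<close>.
\<close>
lemma positive_variation_le_total_variation:
  assumes \<nu>: "locally_finite_complex_measure \<nu>" and \<mu>: "locally_finite_signed_measure \<mu>"
    and le: "\<And>A. \<mu> A \<le> cmod (\<nu> A)"
  shows "positive_variation \<mu> \<le> total_variation \<nu>"
proof (subst le_measure)
  show "\<forall>A\<in>sets (positive_variation \<mu>).
          emeasure (positive_variation \<mu>) A \<le> emeasure (total_variation \<nu>) A"
  proof
    fix A assume "A \<in> sets (positive_variation \<mu>)"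
    then have A: "A \<in> sets borel" by simp
    have "ennreal (\<mu> B) \<le> emeasure (total_variation \<nu>) A"
      if "B \<in> sets borel" "bounded B" "B \<subseteq> A" for B
    proof -
      have "ennreal (\<mu> B) \<le> ennreal (cmod (\<nu> B))" by (intro ennreal_leI le)
      also have "\<dots> \<le> emeasure (total_variation \<nu>) B" by (rule cmod_le_total_variation[OF \<nu> that(1,2)])
      also have "\<dots> \<le> emeasure (total_variation \<nu>) A" using that A by (intro emeasure_mono) auto
      finally show ?thesis .
    qed
    then show "emeasure (positive_variation \<mu>) A \<le> emeasure (total_variation \<nu>) A"
      unfolding emeasure_positive_variation[OF \<mu> A] by (auto intro: SUP_least)
  qed
qed simp

text \<open>
  For \<open>B \<subseteq> A\<close> one has \<open>\<mu> B = \<mu> A + (- \<mu>) (A - B)\<close>; the supremum over \<open>B\<close> gives one inequality, and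
  the same argument for \<open>- \<mu>\<close> gives the other.
\<close>
lemma jordan_decomposition:
  assumes \<mu>: "locally_finite_signed_measure \<mu>" and A: "A \<in> sets borel" "bounded A"
    and fin: "emeasure (positive_variation \<mu>) A < \<infinity>"
      "emeasure (positive_variation (\<lambda>A. - \<mu> A)) A < \<infinity>"
  shows "\<mu> A = measure (positive_variation \<mu>) A - measure (positive_variation (\<lambda>A. - \<mu> A)) A"
proof -
  have *: "measure (positive_variation \<kappa>) A \<le> \<kappa> A + measure (positive_variation (\<lambda>A. - \<kappa> A)) A"
    if \<kappa>: "locally_finite_signed_measure \<kappa>"
      and fin: "emeasure (positive_variation \<kappa>) A < \<infinity>"
        "emeasure (positive_variation (\<lambda>A. - \<kappa> A)) A < \<infinity>" for \<kappa>
  proof -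
    let ?N = "positive_variation (\<lambda>A. - \<kappa> A)"
    note \<kappa>' = locally_finite_signed_measure_uminus[OF \<kappa>]
    have low: "- \<kappa> B \<le> measure ?N A" if B: "B \<in> sets borel" "B \<subseteq> A" for B
    proof -
      have "ennreal (- \<kappa> B) \<le> emeasure ?N A"
        unfolding emeasure_positive_variation[OF \<kappa>' A(1)]
        using B by (intro SUP_upper) (auto intro: bounded_subset[OF A(2)])
      also have "\<dots> = ennreal (measure ?N A)" using fin by (simp add: emeasure_eq_ennreal_measure)
      finally show ?thesis by (simp add: ennreal_le_iff)
    qed
    have up: "ennreal (\<kappa> B) \<le> ennreal (\<kappa> A + measure ?N A)"
      if B: "B \<in> sets borel" "bounded B" "B \<subseteq> A" for B
    proof -
      have "\<kappa> (B \<union> (A - B)) = \<kappa> B + \<kappa> (A - B)"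
        using A B by (intro locally_finite_signed_measure_Un[OF \<kappa>])
          (auto intro: bounded_subset[OF A(2)])
      moreover have "B \<union> (A - B) = A" using B by auto
      moreover have "- \<kappa> (A - B) \<le> measure ?N A" using A B by (intro low) auto
      ultimately show ?thesis by (intro ennreal_leI) simp
    qed
    have "- \<kappa> A \<le> measure ?N A" using A by (intro low) auto
    moreover have "ennreal (measure (positive_variation \<kappa>) A) \<le> ennreal (\<kappa> A + measure ?N A)"
    proof -
      have "ennreal (measure (positive_variation \<kappa>) A) = emeasure (positive_variation \<kappa>) A"
        using fin(1) by (simp add: emeasure_eq_ennreal_measure)
      also have "\<dots> \<le> ennreal (\<kappa> A + measure ?N A)"
        unfolding emeasure_positive_variation[OF \<kappa> A(1)] using up by (auto intro!: SUP_least)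
      finally show ?thesis .
    qed
    ultimately show ?thesis by (simp add: ennreal_le_iff)
  qed
  show ?thesis
    using *[OF \<mu> fin] *[OF locally_finite_signed_measure_uminus[OF \<mu>]] fin by simp
qed

section \<open>The classical Poisson kernel\<close>

definition poisson_kernel :: "real \<Rightarrow> real \<Rightarrow> real" where
  "poisson_kernel t r = t / (pi * (t\<^sup>2 + r\<^sup>2))"

text \<open>
  The derivative of \<open>\<lambda>z. poisson_kernel t (x - z)\<close>, as a function of \<open>r = x - z\<close>.
\<close>
definition poisson_kernel_slope :: "real \<Rightarrow> real \<Rightarrow> real" where
  "poisson_kernel_slope t r = 2 * t * r / (pi * (t\<^sup>2 + r\<^sup>2)\<^sup>2)"

lemma has_real_derivative_poisson_kernel:
  assumes "t > 0"
  shows "((\<lambda>z. poisson_kernel t (x - z)) has_real_derivative poisson_kernel_slope t (x - z)) (at z)"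
proof -
  define A where "A = t\<^sup>2 + (x - z)\<^sup>2"
  have A: "A > 0" using assms by (simp add: add_pos_nonneg A_def)
  have "((\<lambda>z. t / pi * inverse (t\<^sup>2 + (x - z)\<^sup>2)) has_real_derivative
          t / pi * - (inverse A * (- (2 * (x - z))) * inverse A)) (at z)"
    unfolding A_def by (rule derivative_eq_intros refl)+ (use A in \<open>auto simp: A_def\<close>)
  moreover have "t / pi * - (inverse A * (- (2 * (x - z))) * inverse A) = poisson_kernel_slope t (x - z)"
    unfolding poisson_kernel_slope_def A_def[symmetric] by (simp add: divide_inverse power2_eq_square algebra_simps)
  ultimately show ?thesis by (simp add: poisson_kernel_def divide_inverse mult.assoc)
qed

lemma continuous_poisson_kernel_slope:
  assumes "t > 0"
  shows "isCont (\<lambda>z. poisson_kernel_slope t (x - z)) z"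
proof -
  have "t\<^sup>2 + (x - z)\<^sup>2 > 0" using assms by (simp add: add_pos_nonneg)
  then show ?thesis
    unfolding poisson_kernel_slope_def by (intro continuous_intros) auto
qed

lemma has_real_derivative_arctan_poisson:
  assumes "t > 0"
  shows "((\<lambda>z. arctan ((z - x) / t) / pi) has_real_derivative poisson_kernel t (x - z)) (at z)"
proof -
  define A where "A = t\<^sup>2 + (x - z)\<^sup>2"
  have A: "A > 0" using assms by (simp add: add_pos_nonneg A_def)
  have "((\<lambda>z. arctan ((z - x) / t)) has_real_derivative
          inverse (1 + ((z - x) / t)\<^sup>2) * (1 / t)) (at z)"
    by (rule derivative_eq_intros refl)+ (use assms in auto)
  then have "((\<lambda>z. arctan ((z - x) / t) / pi) has_real_derivative
          inverse (1 + ((z - x) / t)\<^sup>2) * (1 / t) / pi) (at z)"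
    by (rule DERIV_cdivide)
  moreover have "1 + ((z - x) / t)\<^sup>2 = A / t\<^sup>2"
    using assms by (simp add: A_def field_simps power2_commute)
  ultimately show ?thesis
    using assms A unfolding poisson_kernel_def A_def[symmetric] by (simp add: power2_eq_square mult.commute)
qed

lemma poisson_kernel_nonneg: "t > 0 \<Longrightarrow> 0 \<le> poisson_kernel t r"
  unfolding poisson_kernel_def by simp

text \<open>
  This is where the cone is needed: \<open>\<bar>z - x\<^sub>0\<bar> \<le> \<bar>x - z\<bar> + \<alpha> * t\<close>, and the extra factor
  \<open>\<bar>x - z\<bar> * \<bar>z - x\<^sub>0\<bar>\<close> absorbs one of the two factors \<open>t\<^sup>2 + (x - z)\<^sup>2\<close> in the denominator.
\<close>
lemma poisson_kernel_slope_bound: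
  assumes "t > 0" "\<bar>x - x\<^sub>0\<bar> \<le> \<alpha> * t" "\<alpha> > 0"
  shows "\<bar>poisson_kernel_slope t (x - z)\<bar> * \<bar>z - x\<^sub>0\<bar> \<le> 2 * (1 + \<alpha>) * poisson_kernel t (x - z)"
proof -
  let ?r = "\<bar>x - z\<bar>" and ?A = "t\<^sup>2 + (x - z)\<^sup>2"
  have A: "?A > 0" using assms by (simp add: add_pos_nonneg)
  have "?r * \<bar>z - x\<^sub>0\<bar> \<le> ?r * (?r + \<alpha> * t)"
    using assms by (intro mult_left_mono) auto
  also have "\<dots> = (x - z)\<^sup>2 + \<alpha> * (t * ?r)" by (simp add: power2_eq_square algebra_simps)
  also have "\<dots> \<le> ?A + \<alpha> * ?A"
  proof (intro add_mono mult_left_mono)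
    have "2 * (t * ?r) \<le> t\<^sup>2 + ?r\<^sup>2" using sum_squares_bound[of t ?r] by simp
    then show "t * ?r \<le> ?A" by simp (smt (verit) assms(1) mult_nonneg_nonneg)
  qed (use assms in auto)
  finally have "?r * \<bar>z - x\<^sub>0\<bar> \<le> (1 + \<alpha>) * ?A" by (simp add: algebra_simps)
  then have "2 * t / (pi * ?A\<^sup>2) * (?r * \<bar>z - x\<^sub>0\<bar>) \<le> 2 * t / (pi * ?A\<^sup>2) * ((1 + \<alpha>) * ?A)"
    using assms A by (intro mult_left_mono) auto
  also have "\<dots> = 2 * (1 + \<alpha>) * poisson_kernel t (x - z)"
    using A by (simp add: poisson_kernel_def power2_eq_square)
  also have "2 * t / (pi * ?A\<^sup>2) * (?r * \<bar>z - x\<^sub>0\<bar>) = \<bar>poisson_kernel_slope t (x - z)\<bar> * \<bar>z - x\<^sub>0\<bar>"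
    using assms A by (simp add: poisson_kernel_slope_def abs_mult)
  finally show ?thesis .
qed

text \<open>
  Away from \<open>x\<^sub>0\<close> the kernel is of order \<open>t\<close>; in this form the bound is uniform in \<open>z\<close>, so no
  splitting of the integral is required.
\<close>
lemma poisson_kernel_second_moment:
  assumes "t > 0" "\<bar>x - x\<^sub>0\<bar> \<le> \<alpha> * t" "\<alpha> > 0"
  shows "poisson_kernel t (x - z) * (z - x\<^sub>0)\<^sup>2 \<le> 2 * (1 + \<alpha>\<^sup>2) * t / pi"
proof -
  let ?A = "t\<^sup>2 + (x - z)\<^sup>2"
  have A: "?A > 0" using assms by (simp add: add_pos_nonneg)
  have "(x - x\<^sub>0)\<^sup>2 \<le> (\<alpha> * t)\<^sup>2" using assms by (simp add: abs_le_square_iff[symmetric])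
  moreover have "(z - x\<^sub>0)\<^sup>2 \<le> 2 * (x - z)\<^sup>2 + 2 * (x - x\<^sub>0)\<^sup>2"
    using zero_le_power2[of "(x - z) + (x - x\<^sub>0)"] by (simp add: power2_eq_square algebra_simps)
  moreover have "0 \<le> \<alpha>\<^sup>2 * (x - z)\<^sup>2" "0 \<le> t\<^sup>2" by auto
  ultimately have "(z - x\<^sub>0)\<^sup>2 \<le> 2 * (1 + \<alpha>\<^sup>2) * ?A"
    unfolding power_mult_distrib distrib_left distrib_right mult_1_right mult.assoc by linarith
  then have "t / (pi * ?A) * (z - x\<^sub>0)\<^sup>2 \<le> t / (pi * ?A) * (2 * (1 + \<alpha>\<^sup>2) * ?A)"
    using assms A by (intro mult_left_mono) auto
  also have "\<dots> = 2 * (1 + \<alpha>\<^sup>2) * t / pi" using A by simp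
  finally show ?thesis by (simp add: poisson_kernel_def)
qed

text \<open>
  Write \<open>p b - p y\<close> as the integral of \<open>p'\<close> over \<open>{y..b}\<close> and apply Fubini's theorem on the triangle
  \<open>a < y \<le> z \<le> b\<close>.
\<close>
lemma has_bochner_integral_by_parts_distribution:
  fixes p p' :: "real \<Rightarrow> real"
  assumes M: "sets M = sets borel" "emeasure M {a<..b} < \<infinity>" and "a \<le> b"
    and p: "\<And>z. (p has_real_derivative p' z) (at z)" and p': "\<And>z. isCont p' z"
  shows "has_bochner_integral lborel (\<lambda>z. indicator {a..b} z * (p' z * measure M {a<..z}))
           (p b * measure M {a<..b} - (\<integral>y. indicator {a<..b} y * p y \<partial>M))"
proof -
  note [measurable_cong] = M(1)
  have sp: "space M = UNIV" using sets_eq_imp_space_eq[OF M(1)] by simp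
  define N where "N = density M (indicator {a<..b})"
  have sN [measurable_cong]: "sets N = sets borel" by (simp add: N_def M)
  have spN: "space N = UNIV" by (simp add: N_def sp)
  have eN: "emeasure N A = emeasure M ({a<..b} \<inter> A)" if "A \<in> sets borel" for A
    using that unfolding N_def by (subst emeasure_density) (auto simp: M indicator_inter_arith[symmetric]
      intro!: nn_integral_indicator)
  have mN: "measure N A = measure M ({a<..b} \<inter> A)" if "A \<in> sets borel" for A
    using eN[OF that] by (simp add: measure_def)
  have "finite_measure N"
    by (rule finite_measureI) (use M(2) in \<open>simp add: spN eN\<close>)
  then interpret N: finite_measure N .
  interpret pair_sigma_finite N lborel ..
  have pm [measurable]: "p \<in> borel_measurable borel" "p' \<in> borel_measurable borel"
    using p p' by (auto intro!: borel_measurable_continuous_onI continuous_at_imp_continuous_on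
        intro: DERIV_isCont)
  have "compact (p' ` {a..b})"
    using p' by (intro compact_continuous_image continuous_at_imp_continuous_on) auto
  then have "bounded (p' ` {a..b})" by (rule compact_imp_bounded)
  then obtain B where "\<forall>y \<in> p' ` {a..b}. norm y \<le> B" unfolding bounded_iff by blast
  then have B: "\<bar>p' z\<bar> \<le> B" if "z \<in> {a..b}" for z using that by auto
  define f where "f y z = (if a < y \<and> y \<le> z \<and> z \<le> b then p' z else 0)" for y z
  have [measurable]: "case_prod f \<in> borel_measurable (N \<Otimes>\<^sub>M lborel)"
    unfolding f_def by measurable
  have int: "integrable (N \<Otimes>\<^sub>M lborel) (case_prod f)"
  proof (rule integrableI_bounded_set[where A = "UNIV \<times> {a..b}" and B = B])
    show "UNIV \<times> {a..b} \<in> sets (N \<Otimes>\<^sub>M lborel)"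
      using spN sets.top[of N] by (intro pair_measureI) auto
    show "emeasure (N \<Otimes>\<^sub>M lborel) (UNIV \<times> {a..b}) < \<infinity>"
    proof -
      have "emeasure N UNIV < top" by (simp add: less_top[symmetric])
      then show ?thesis
        using spN sets.top[of N] \<open>a \<le> b\<close>
        by (subst lborel.emeasure_pair_measure_Times) (auto simp: ennreal_mult_less_top)
    qed
    have "0 \<le> B" using B[of a] \<open>a \<le> b\<close> by auto
    then show "AE q in N \<Otimes>\<^sub>M lborel. q \<in> UNIV \<times> {a..b} \<longrightarrow> norm (case_prod f q) \<le> B"
      using B by (auto simp: f_def)
    show "AE q in N \<Otimes>\<^sub>M lborel. q \<notin> UNIV \<times> {a..b} \<longrightarrow> case_prod f q = 0"
      by (intro AE_I2) (auto simp: f_def split: prod.split)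
  qed measurable
  have inner_N: "(\<integral>y. f y z \<partial>N) = indicator {a..b} z * (p' z * measure M {a<..z})" for z
  proof (cases "z \<in> {a..b}")
    case True
    then have "(\<integral>y. f y z \<partial>N) = (\<integral>y. p' z * indicator {a<..z} y \<partial>N)"
      by (intro Bochner_Integration.integral_cong) (auto simp: f_def split: split_indicator)
    also have "\<dots> = p' z * measure N {a<..z}"
      using spN by simp
    also have "measure N {a<..z} = measure M {a<..z}"
      using True by (subst mN) (auto intro!: arg_cong[where f = "measure M"])
    finally show ?thesis using True by simp
  next
    case False
    then have "f y z = 0" for y by (auto simp: f_def)
    with False show ?thesis by simp
  qed
  have inner_l: "(\<integral>z. f y z \<partial>lborel) = indicator {a<..b} y * (p b - p y)" for y
  proof (cases "y \<in> {a<..b}")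
    case True
    then have "(\<integral>z. f y z \<partial>lborel) = (\<integral>z. p' z * indicator {y..b} z \<partial>lborel)"
      by (intro Bochner_Integration.integral_cong) (auto simp: f_def split: split_indicator)
    also have "\<dots> = p b - p y"
      using True by (intro integral_FTC_Icc_real p p') auto
    finally show ?thesis using True by simp
  next
    case False
    then have "f y z = 0" for z by (auto simp: f_def)
    with False show ?thesis by simp
  qed
  have "compact (p ` {a..b})"
    using p by (intro compact_continuous_image continuous_at_imp_continuous_on) (auto intro: DERIV_isCont)
  then have "bounded (p ` {a..b})" by (rule compact_imp_bounded)
  then obtain B' where "\<forall>y \<in> p ` {a..b}. norm y \<le> B'" unfolding bounded_iff by blast
  then have B': "\<bar>p z\<bar> \<le> B'" if "z \<in> {a..b}" for z using that by auto
  have pint: "integrable M (\<lambda>y. indicator {a<..b} y * p y)"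
    by (rule integrableI_bounded_set[where A = "{a<..b}" and B = B']) (use B' M in \<open>auto\<close>)
  have cint: "integrable M (\<lambda>y. indicator {a<..b} y * p b)"
    by (rule integrableI_bounded_set[where A = "{a<..b}" and B = "\<bar>p b\<bar>"]) (use M in \<open>auto\<close>)
  have int_z: "integrable lborel (\<lambda>z. \<integral>y. f y z \<partial>N)" using int by (rule integrable_snd)
  have "(\<integral>z. (\<integral>y. f y z \<partial>N) \<partial>lborel) = (\<integral>y. (\<integral>z. f y z \<partial>lborel) \<partial>N)"
    using int by (rule Fubini_integral)
  also have "\<dots> = (\<integral>y. indicator {a<..b} y * (p b - p y) \<partial>N)" by (simp add: inner_l)
  also have "\<dots> = (\<integral>y. indicator {a<..b} y * p b - indicator {a<..b} y * p y \<partial>M)"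
  proof -
    have "N = density M (\<lambda>y. ennreal (indicator {a<..b} y))" by (simp add: N_def ennreal_indicator)
    then show ?thesis
      by (simp add: integral_density M) 
         (intro Bochner_Integration.integral_cong, auto split: split_indicator)
  qed
  also have "\<dots> = p b * measure M {a<..b} - (\<integral>y. indicator {a<..b} y * p y \<partial>M)"
    using sp by (simp add: Bochner_Integration.integral_diff[OF cint pint])
  finally show ?thesis
    using int_z by (simp add: has_bochner_integral_iff inner_N)
qed

text \<open>
  Fatou's theorem on a bounded interval.  After integration by parts \<open>H\<close> is split into its affine part
  at \<open>x\<^sub>0\<close> and the remainder \<open>G\<close>.  The bound \<open>\<bar>G z\<bar> \<le> \<bar>z - x\<^sub>0\<bar> * (e + c * (z - x\<^sub>0)\<^sup>2)\<close> holds on the whole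
  interval with \<open>e\<close> arbitrarily small: differentiability gives it near \<open>x\<^sub>0\<close>, and boundedness of \<open>G\<close>
  elsewhere.  The first factor is consumed by the kernel derivative, the term with \<open>e\<close> is integrated
  against \<open>p\<close>, and the term with \<open>c\<close> is \<open>O(t)\<close> by the second moment bound.
\<close>
lemma nontangential_limit_poisson_integral:
  fixes M N :: "real measure" and H :: "real \<Rightarrow> real"
  assumes M: "sets M = sets borel" "emeasure M {a<..b} < \<infinity>"
    and N: "sets N = sets borel" "emeasure N {a<..b} < \<infinity>"
    and x0: "a < x\<^sub>0" "x\<^sub>0 < b" and \<alpha>: "0 < \<alpha>"
    and H_def: "H = (\<lambda>z. measure M {a<..z} - measure N {a<..z})"
    and H: "(H has_real_derivative D) (at x\<^sub>0)"
  shows "((\<lambda>(t, x). (\<integral>y. indicator {a<..b} y * poisson_kernel t (x - y) \<partial>M) -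
                   (\<integral>y. indicator {a<..b} y * poisson_kernel t (x - y) \<partial>N)) \<longlongrightarrow> D)
           (at (0, x\<^sub>0) within {(t, x). 0 < t \<and> \<bar>x - x\<^sub>0\<bar> < \<alpha> * t})"
    (is "(?J \<longlongrightarrow> D) ?F")
proof -
  \<comment> \<open>As a function of the end point \<open>c\<close>, \<open>E c\<close> is an antiderivative of the kernel derivative times the
      affine part of \<open>H\<close> at \<open>x\<^sub>0\<close>, so \<open>A\<close> is the contribution of the affine part together with the
      boundary term at \<open>b\<close>.\<close>
  define E where "E c = (\<lambda>q. poisson_kernel (fst q) (snd q - c) * (H x\<^sub>0 + D * (c - x\<^sub>0)) -
    D * (arctan ((c - snd q) / fst q) / pi))" for c
  define A where "A = (\<lambda>q. poisson_kernel (fst q) (snd q - b) * H b - E b q + E a q)"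
  have tx: "(fst \<longlongrightarrow> 0) ?F" "(snd \<longlongrightarrow> x\<^sub>0) ?F"
    by (auto intro!: tendsto_eq_intros simp: tendsto_fst tendsto_snd)
  have cone: "\<forall>\<^sub>F q in ?F. 0 < fst q \<and> \<bar>snd q - x\<^sub>0\<bar> < \<alpha> * fst q"
    unfolding eventually_at_filter by (auto intro!: always_eventually)
  have p0: "((\<lambda>q. poisson_kernel (fst q) (snd q - c)) \<longlongrightarrow> 0) ?F" if "c \<noteq> x\<^sub>0" for c
  proof -
    have "((\<lambda>q. fst q / (pi * ((fst q)\<^sup>2 + (snd q - c)\<^sup>2))) \<longlongrightarrow>
            0 / (pi * (0\<^sup>2 + (x\<^sub>0 - c)\<^sup>2))) ?F"
      by (intro tendsto_intros tx) (use that in auto)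
    then show ?thesis by (simp add: poisson_kernel_def)
  qed
  have tinv: "filterlim (\<lambda>q. inverse (fst q)) at_top ?F"
    by (rule filterlim_inverse_at_top[OF tx(1)]) (use cone in \<open>auto elim: eventually_mono\<close>)
  have "filterlim (\<lambda>q. (b - snd q) / fst q) at_top ?F"
    unfolding divide_inverse
    by (rule filterlim_tendsto_pos_mult_at_top[OF _ _ tinv, where c = "b - x\<^sub>0"])
       (use x0 in \<open>auto intro!: tendsto_intros tx\<close>)
  then have atb: "((\<lambda>q. arctan ((b - snd q) / fst q)) \<longlongrightarrow> pi / 2) ?F"
    by (rule filterlim_compose[OF tendsto_arctan_at_top])
  have "filterlim (\<lambda>q. (a - snd q) / fst q) at_bot ?F"
    unfolding divide_inverse
    by (rule filterlim_tendsto_neg_mult_at_bot[OF _ _ tinv, where c = "a - x\<^sub>0"])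
       (use x0 in \<open>auto intro!: tendsto_intros tx\<close>)
  then have ata: "((\<lambda>q. arctan ((a - snd q) / fst q)) \<longlongrightarrow> - (pi / 2)) ?F"
    by (rule filterlim_compose[OF tendsto_arctan_at_bot])
  have A: "(A \<longlongrightarrow> D) ?F"
  proof -
    have "(A \<longlongrightarrow> 0 * H b - (0 * (H x\<^sub>0 + D * (b - x\<^sub>0)) - D * (pi / 2 / pi)) +
             (0 * (H x\<^sub>0 + D * (a - x\<^sub>0)) - D * (- (pi / 2) / pi))) ?F"
      unfolding A_def E_def using x0
      by (intro tendsto_add tendsto_diff tendsto_mult tendsto_divide tendsto_const p0 ata atb) auto
    then show ?thesis by (simp add: field_simps)
  qed
  define G where "G z = H z - (H x\<^sub>0 + D * (z - x\<^sub>0))" for z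
  define B where "B = measure M {a<..b} + measure N {a<..b} + \<bar>H x\<^sub>0\<bar> + \<bar>D\<bar> * (b - a)"
  have GB: "\<bar>G z\<bar> \<le> B" if z: "z \<in> {a..b}" for z
  proof -
    have "measure M {a<..z} \<le> measure M {a<..b}" "measure N {a<..z} \<le> measure N {a<..b}"
      using z M N by (auto intro!: measure_mono_fmeasurable simp: fmeasurable_def)
    then have "\<bar>H z\<bar> \<le> measure M {a<..b} + measure N {a<..b}"
      unfolding H_def using measure_nonneg[of M "{a<..z}"] measure_nonneg[of N "{a<..z}"] by linarith
    moreover have "\<bar>D * (z - x\<^sub>0)\<bar> \<le> \<bar>D\<bar> * (b - a)"
      unfolding abs_mult using z x0 by (intro mult_left_mono) auto
    ultimately show ?thesis unfolding G_def B_def by linarith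
  qed
  have estimate: "\<bar>?J (t, x) - A (t, x)\<bar> \<le> 2 * (1 + \<alpha>) * (e + c * (2 * (1 + \<alpha>\<^sup>2) * t / pi) * (b - a))"
    if t: "0 < t" and x: "\<bar>x - x\<^sub>0\<bar> < \<alpha> * t" and e: "0 \<le> e" and c: "0 \<le> c"
      and G: "\<And>z. z \<in> {a..b} \<Longrightarrow> \<bar>G z\<bar> \<le> \<bar>z - x\<^sub>0\<bar> * (e + c * (z - x\<^sub>0)\<^sup>2)" for t x e c
  proof -
    let ?p = "\<lambda>z. poisson_kernel t (x - z)" and ?p' = "\<lambda>z. poisson_kernel_slope t (x - z)"
    note p = has_real_derivative_poisson_kernel[OF t, of x] continuous_poisson_kernel_slope[OF t, where x = x]
    have "has_bochner_integral lborel (\<lambda>z. indicator {a..b} z * (?p' z * measure M {a<..z}) -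
        indicator {a..b} z * (?p' z * measure N {a<..z}))
        ((?p b * measure M {a<..b} - (\<integral>y. indicator {a<..b} y * ?p y \<partial>M)) -
         (?p b * measure N {a<..b} - (\<integral>y. indicator {a<..b} y * ?p y \<partial>N)))"
      using x0 by (intro has_bochner_integral_diff has_bochner_integral_by_parts_distribution M N p) auto
    also have "(\<lambda>z. indicator {a..b} z * (?p' z * measure M {a<..z}) -
        indicator {a..b} z * (?p' z * measure N {a<..z})) = (\<lambda>z. indicator {a..b} z * (?p' z * H z))"
      by (simp add: H_def algebra_simps)
    also have "(?p b * measure M {a<..b} - (\<integral>y. indicator {a<..b} y * ?p y \<partial>M)) -
         (?p b * measure N {a<..b} - (\<integral>y. indicator {a<..b} y * ?p y \<partial>N)) = ?p b * H b - ?J (t, x)"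
      by (simp add: H_def algebra_simps)
    finally have 1: "has_bochner_integral lborel (\<lambda>z. indicator {a..b} z * (?p' z * H z))
      (?p b * H b - ?J (t, x))" .
    have 2: "has_bochner_integral lborel (\<lambda>z. ?p' z * (H x\<^sub>0 + D * (z - x\<^sub>0)) * indicator {a..b} z)
        (E b (t, x) - E a (t, x))"
    proof (rule has_bochner_integral_FTC_Icc_real)
      fix z
      show "((\<lambda>c. E c (t, x)) has_real_derivative ?p' z * (H x\<^sub>0 + D * (z - x\<^sub>0))) (at z)"
        unfolding E_def fst_conv snd_conv
        by (rule derivative_eq_intros p has_real_derivative_arctan_poisson[OF t] refl)+
           (simp add: algebra_simps)
      show "isCont (\<lambda>z. ?p' z * (H x\<^sub>0 + D * (z - x\<^sub>0))) z" by (intro continuous_intros p)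
    qed (use x0 in auto)
    have 3: "has_bochner_integral lborel (\<lambda>z. indicator {a..b} z * (?p' z * G z)) (A (t, x) - ?J (t, x))"
      using has_bochner_integral_diff[OF 1 2] by (simp add: A_def G_def algebra_simps)
    have 4: "has_bochner_integral lborel
        (\<lambda>z. 2 * (1 + \<alpha>) * (e * ?p z + c * (2 * (1 + \<alpha>\<^sup>2) * t / pi)) * indicator {a..b} z)
        (2 * (1 + \<alpha>) * (e * (arctan ((b - x) / t) / pi) + c * (2 * (1 + \<alpha>\<^sup>2) * t / pi) * b) -
         2 * (1 + \<alpha>) * (e * (arctan ((a - x) / t) / pi) + c * (2 * (1 + \<alpha>\<^sup>2) * t / pi) * a))"
    proof (rule has_bochner_integral_FTC_Icc_real)
      fix z
      show "((\<lambda>z. 2 * (1 + \<alpha>) * (e * (arctan ((z - x) / t) / pi) + c * (2 * (1 + \<alpha>\<^sup>2) * t / pi) * z))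
         has_real_derivative 2 * (1 + \<alpha>) * (e * ?p z + c * (2 * (1 + \<alpha>\<^sup>2) * t / pi))) (at z)"
        by (rule derivative_eq_intros has_real_derivative_arctan_poisson[OF t] refl)+ simp
      have "isCont ?p z" using p(1) by (rule DERIV_isCont)
      then show "isCont (\<lambda>z. 2 * (1 + \<alpha>) * (e * ?p z + c * (2 * (1 + \<alpha>\<^sup>2) * t / pi))) z"
        by (intro continuous_intros)
    qed (use x0 in auto)
    have "\<bar>indicator {a..b} z * (?p' z * G z)\<bar> \<le>
        2 * (1 + \<alpha>) * (e * ?p z + c * (2 * (1 + \<alpha>\<^sup>2) * t / pi)) * indicator {a..b} z" for z
    proof (cases "z \<in> {a..b}")
      case True
      have "\<bar>?p' z * G z\<bar> \<le> \<bar>?p' z\<bar> * (\<bar>z - x\<^sub>0\<bar> * (e + c * (z - x\<^sub>0)\<^sup>2))"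
        unfolding abs_mult by (intro mult_left_mono G True) auto
      also have "\<dots> = (\<bar>?p' z\<bar> * \<bar>z - x\<^sub>0\<bar>) * (e + c * (z - x\<^sub>0)\<^sup>2)" by simp
      also have "\<dots> \<le> (2 * (1 + \<alpha>) * ?p z) * (e + c * (z - x\<^sub>0)\<^sup>2)"
        using t x \<alpha> e c by (intro mult_right_mono poisson_kernel_slope_bound) auto
      also have "\<dots> = 2 * (1 + \<alpha>) * (e * ?p z + c * (?p z * (z - x\<^sub>0)\<^sup>2))" by (simp add: algebra_simps)
      also have "\<dots> \<le> 2 * (1 + \<alpha>) * (e * ?p z + c * (2 * (1 + \<alpha>\<^sup>2) * t / pi))"
        using t x \<alpha> e c by (intro mult_left_mono add_left_mono poisson_kernel_second_moment) auto
      finally show ?thesis using True by simp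
    qed simp
    then have "\<bar>\<integral>z. indicator {a..b} z * (?p' z * G z) \<partial>lborel\<bar> \<le>
        (\<integral>z. 2 * (1 + \<alpha>) * (e * ?p z + c * (2 * (1 + \<alpha>\<^sup>2) * t / pi)) * indicator {a..b} z \<partial>lborel)"
      using 3 4 by (intro integral_abs_bound_integral) (auto simp: has_bochner_integral_iff)
    then have "\<bar>?J (t, x) - A (t, x)\<bar> \<le>
        2 * (1 + \<alpha>) * (e * (arctan ((b - x) / t) / pi) + c * (2 * (1 + \<alpha>\<^sup>2) * t / pi) * b) -
        2 * (1 + \<alpha>) * (e * (arctan ((a - x) / t) / pi) + c * (2 * (1 + \<alpha>\<^sup>2) * t / pi) * a)"
      using has_bochner_integral_integral_eq[OF 3] has_bochner_integral_integral_eq[OF 4]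
      by (simp add: abs_minus_commute)
    also have "\<dots> = 2 * (1 + \<alpha>) * (e * ((arctan ((b - x) / t) - arctan ((a - x) / t)) / pi) +
        c * (2 * (1 + \<alpha>\<^sup>2) * t / pi) * (b - a))" by (simp add: algebra_simps diff_divide_distrib)
    also have "\<dots> \<le> 2 * (1 + \<alpha>) * (e * 1 + c * (2 * (1 + \<alpha>\<^sup>2) * t / pi) * (b - a))"
    proof (intro mult_left_mono add_right_mono)
      show "(arctan ((b - x) / t) - arctan ((a - x) / t)) / pi \<le> 1"
        using arctan_ubound[of "(b - x) / t"] arctan_lbound[of "(a - x) / t"] by (simp add: field_simps)
    qed (use e \<alpha> in auto)
    finally show ?thesis by simp
  qed
  have "((\<lambda>q. ?J q - A q) \<longlongrightarrow> 0) ?F"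
  proof (rule tendstoI)
    fix r :: real assume r: "r > 0"
    \<comment> \<open>Chosen so that the limit of the bound in \<open>estimate\<close> as \<open>t\<close> tends to \<open>0\<close> is \<open>r / 2\<close>.\<close>
    define e where "e = r / (4 * (1 + \<alpha>))"
    have e: "e > 0" using r \<alpha> by (simp add: e_def)
    obtain d where d: "d > 0" "\<And>z. \<bar>z - x\<^sub>0\<bar> < d \<Longrightarrow> \<bar>G z\<bar> \<le> e * \<bar>z - x\<^sub>0\<bar>"
    proof -
      have "(H has_derivative (\<lambda>h. D * h)) (at x\<^sub>0)"
        using H by (simp add: has_field_derivative_def mult_commute_abs)
      then obtain d where "d > 0" "\<And>z. norm (z - x\<^sub>0) < d \<Longrightarrow>
          norm (H z - H x\<^sub>0 - D * (z - x\<^sub>0)) \<le> e * norm (z - x\<^sub>0)"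
        using e unfolding has_derivative_at_alt by metis
      then show ?thesis by (intro that[of d]) (auto simp: G_def algebra_simps)
    qed
    \<comment> \<open>With this constant the crude bound \<open>B\<close> is absorbed by \<open>c * \<bar>z - x\<^sub>0\<bar> ^ 3\<close> where \<open>\<bar>z - x\<^sub>0\<bar> \<ge> d\<close>; the
        square left after removing \<open>\<bar>z - x\<^sub>0\<bar>\<close> is what the second moment bound takes.\<close>
    define c where "c = B / d ^ 3"
    have B0: "0 \<le> B" using GB[of a] x0 by auto
    then have c: "0 \<le> c" using d by (simp add: c_def)
    have G: "\<bar>G z\<bar> \<le> \<bar>z - x\<^sub>0\<bar> * (e + c * (z - x\<^sub>0)\<^sup>2)" if z: "z \<in> {a..b}" for z
    proof (cases "\<bar>z - x\<^sub>0\<bar> < d")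
      case True
      have "\<bar>G z\<bar> \<le> \<bar>z - x\<^sub>0\<bar> * e" using d(2)[OF True] by (simp add: mult.commute)
      also have "\<dots> \<le> \<bar>z - x\<^sub>0\<bar> * (e + c * (z - x\<^sub>0)\<^sup>2)" using c by (intro mult_left_mono) auto
      finally show ?thesis .
    next
      case False
      have "\<bar>G z\<bar> \<le> c * d ^ 3" using GB[OF z] d by (simp add: c_def)
      also have "\<dots> \<le> c * \<bar>z - x\<^sub>0\<bar> ^ 3" using False d c by (intro mult_left_mono power_mono) auto
      also have "\<dots> = \<bar>z - x\<^sub>0\<bar> * (c * \<bar>z - x\<^sub>0\<bar>\<^sup>2)" by (simp add: power2_eq_square power3_eq_cube)
      also have "\<dots> \<le> \<bar>z - x\<^sub>0\<bar> * (e + c * (z - x\<^sub>0)\<^sup>2)" using e by (intro mult_left_mono) auto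
      finally show ?thesis .
    qed
    have "((\<lambda>q. 2 * (1 + \<alpha>) * (e + c * (2 * (1 + \<alpha>\<^sup>2) * fst q / pi) * (b - a))) \<longlongrightarrow>
      2 * (1 + \<alpha>) * (e + c * (2 * (1 + \<alpha>\<^sup>2) * 0 / pi) * (b - a))) ?F"
      by (intro tendsto_intros tx) auto
    also have "2 * (1 + \<alpha>) * (e + c * (2 * (1 + \<alpha>\<^sup>2) * 0 / pi) * (b - a)) = r / 2"
      using \<alpha> by (simp add: e_def field_simps)
    finally have "\<forall>\<^sub>F q in ?F. 2 * (1 + \<alpha>) * (e + c * (2 * (1 + \<alpha>\<^sup>2) * fst q / pi) * (b - a)) < r"
      by (rule order_tendstoD) (use r in simp)
    with cone show "\<forall>\<^sub>F q in ?F. dist (?J q - A q) 0 < r"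
    proof eventually_elim
      case (elim q)
      then show ?case
        using estimate[of "fst q" "snd q" e c] e c G by (auto simp: dist_real_def)
    qed
  qed
  from tendsto_add[OF this A] show ?thesis by simp
qed

section \<open>Comparison of the kernels on bounded sets\<close>

text \<open>
  Some of the integrands below have integrable singularities at the end points, so differentiability of the
  antiderivative is only available in the open interval.
\<close>
lemma has_bochner_integral_FTC_Ioo_nonneg:
  fixes f F :: "real \<Rightarrow> real"
  assumes "a \<le> b" "continuous_on {a..b} F"
    and deriv: "\<And>s. a < s \<Longrightarrow> s < b \<Longrightarrow> (F has_real_derivative f s) (at s)"
    and nonneg: "\<And>s. a < s \<Longrightarrow> s < b \<Longrightarrow> 0 \<le> f s"
    and [measurable]: "f \<in> borel_measurable borel"
  shows "has_bochner_integral lborel (\<lambda>s. indicator {a<..<b} s * f s) (F b - F a)"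
proof -
  have "(f has_integral F b - F a) {a..b}"
    using assms by (intro fundamental_theorem_of_calculus_interior)
      (auto simp: has_real_derivative_iff_has_vector_derivative[symmetric])
  then have "(f has_integral F b - F a) {a<..<b}"
    by (simp add: has_integral_Icc_iff_Ioo)
  then have "((\<lambda>s. if s \<in> {a<..<b} then f s else 0) has_integral F b - F a) UNIV"
    by (simp only: has_integral_restrict_UNIV)
  also have "(\<lambda>s. if s \<in> {a<..<b} then f s else 0) = (\<lambda>s. indicator {a<..<b} s * f s)"
    by (auto split: split_indicator)
  finally have int: "((\<lambda>s. indicator {a<..<b} s * f s) has_integral F b - F a) UNIV" .
  have nn: "0 \<le> indicator {a<..<b} s * f s" for s
    using nonneg by (auto split: split_indicator)
  have "(\<integral>\<^sup>+s. ennreal (indicator {a<..<b} s * f s) \<partial>lborel) = ennreal (F b - F a)"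
    by (rule nn_integral_has_integral_lborel[OF _ nn int]) measurable
  moreover have "0 \<le> F b - F a" using int nn by (rule has_integral_nonneg)
  ultimately show ?thesis
    using nn by (intro has_bochner_integral_nn_integral) auto
qed

lemma has_real_derivative_kappa:
  assumes "0 \<le> s" "s < 1"
  shows "(kappa has_real_derivative 4 / (1 - s\<^sup>2)) (at s)" "0 < 1 - s\<^sup>2"
proof -
  have "s * s < 1 * 1" using assms by (intro mult_strict_mono') auto
  then show pos: "0 < 1 - s\<^sup>2" by (simp add: power2_eq_square)
  have "((\<lambda>s. 2 * (ln (1 + s) - ln (1 - s))) has_real_derivative
           2 * (1 / (1 + s) * 1 - 1 / (1 - s) * (- 1))) (at s)"
    using assms by (auto intro!: derivative_eq_intros)
  moreover have "2 * (1 / (1 + s) * 1 - 1 / (1 - s) * (- 1)) = 4 / (1 - s\<^sup>2)"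
  proof -
    have "1 - s\<^sup>2 = (1 + s) * (1 - s)" by (simp add: power2_eq_square algebra_simps)
    then show ?thesis using assms by (simp add: field_simps)
  qed
  moreover have "\<forall>\<^sub>F u in nhds s. u \<in> {-1<..<1}"
    using assms by (intro eventually_nhds_in_open) auto
  then have "\<forall>\<^sub>F u in nhds s. 2 * (ln (1 + u) - ln (1 - u)) = kappa u"
    by eventually_elim (auto simp: kappa_def ln_div)
  ultimately show "(kappa has_real_derivative 4 / (1 - s\<^sup>2)) (at s)"
    by (simp only: DERIV_cong_ev[OF refl _ refl])
qed

text \<open>
  Here \<open>kappa s = 4 * artanh s\<close>.  This bound and \<open>kappa_le\<close> follow by comparing derivatives; together
  they give \<open>1 - s\<^sup>2 \<le> 4 * s / kappa s \<le> 1\<close>.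
\<close>
lemma kappa_ge:
  assumes "0 < s" "s < 1"
  shows "4 * s \<le> kappa s"
proof -
  have "kappa 0 - 4 * 0 \<le> kappa s - 4 * s"
  proof (rule DERIV_nonneg_imp_nondecreasing[of 0 s "\<lambda>u. kappa u - 4 * u"])
    fix u assume "0 \<le> u" "u \<le> s"
    with assms have u: "0 \<le> u" "u < 1" by auto
    note k = has_real_derivative_kappa[OF u]
    have "((\<lambda>u. kappa u - 4 * u) has_real_derivative 4 / (1 - u\<^sup>2) - 4) (at u)"
      by (rule DERIV_diff[OF k(1) DERIV_cmult_Id])
    moreover have "0 \<le> 4 / (1 - u\<^sup>2) - 4" using k(2) by (simp add: field_simps)
    ultimately show "\<exists>y. ((\<lambda>u. kappa u - 4 * u) has_real_derivative y) (at u) \<and> 0 \<le> y"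
      by blast
  qed (use assms in auto)
  then show ?thesis by (simp add: kappa_def)
qed

lemma kappa_le:
  assumes "0 < s" "s < 1"
  shows "kappa s \<le> 4 * s / (1 - s\<^sup>2)"
proof -
  have "4 * 0 / (1 - 0\<^sup>2) - kappa 0 \<le> 4 * s / (1 - s\<^sup>2) - kappa s"
  proof (rule DERIV_nonneg_imp_nondecreasing[of 0 s "\<lambda>u. 4 * u / (1 - u\<^sup>2) - kappa u"])
    fix u assume "0 \<le> u" "u \<le> s"
    with assms have u: "0 \<le> u" "u < 1" by auto
    note k = has_real_derivative_kappa[OF u]
    let ?D = "(4 * (1 - u\<^sup>2) - 4 * u * (- (2 * u))) / ((1 - u\<^sup>2) * (1 - u\<^sup>2))"
    have "((\<lambda>u. 4 * u) has_real_derivative 4) (at u)" by (rule DERIV_cmult_Id)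
    moreover have "((\<lambda>u. 1 - u\<^sup>2) has_real_derivative - (2 * u)) (at u)"
      by (auto intro!: derivative_eq_intros)
    ultimately have "((\<lambda>u. 4 * u / (1 - u\<^sup>2)) has_real_derivative ?D) (at u)"
      by (rule DERIV_divide) (use k(2) in linarith)
    then have "((\<lambda>u. 4 * u / (1 - u\<^sup>2) - kappa u) has_real_derivative ?D - 4 / (1 - u\<^sup>2)) (at u)"
      by (rule DERIV_diff[OF _ k(1)])
    moreover have "4 / (1 - u\<^sup>2) = 4 * (1 - u\<^sup>2) / ((1 - u\<^sup>2) * (1 - u\<^sup>2))"
      by (rule nonzero_mult_divide_mult_cancel_right[symmetric]) (use k(2) in linarith)
    then have "0 \<le> ?D - 4 / (1 - u\<^sup>2)"
      using k(2) by (simp only: diff_ge_0_iff_ge) (intro divide_right_mono, auto)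
    ultimately show "\<exists>y. ((\<lambda>u. 4 * u / (1 - u\<^sup>2) - kappa u) has_real_derivative y) (at u) \<and> 0 \<le> y"
      by blast
  qed (use assms in auto)
  then show ?thesis by (simp add: kappa_def)
qed

lemma kappa_measurable [measurable]: "kappa \<in> borel_measurable borel"
  unfolding kappa_def by measurable

definition mehler_integrand :: "real \<Rightarrow> real \<Rightarrow> real \<Rightarrow> real \<Rightarrow> real" where
  "mehler_integrand t x y s = exp (- (t\<^sup>2 / kappa s)) * (1 - s\<^sup>2) powr (-1/2) *
     exp (- (1/4) * (\<bar>x - y\<bar>\<^sup>2 / s + s * \<bar>x + y\<bar>\<^sup>2)) / (s powr (1/2) * kappa s powr (3/2))"

text \<open>
  The limiting form of the Mehler integrand for small \<open>s\<close>, with \<open>A = t\<^sup>2 + (x - y)\<^sup>2\<close>; its integral over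
  \<open>{0<..}\<close> is \<open>1 / (2 * A)\<close>.
\<close>
definition poisson_integrand :: "real \<Rightarrow> real \<Rightarrow> real" where
  "poisson_integrand A s = exp (- (A / (4 * s))) / (8 * s\<^sup>2)"

lemma mehler_integrand_measurable [measurable]:
  "(\<lambda>(y, s). mehler_integrand t x y s) \<in> borel_measurable (borel \<Otimes>\<^sub>M borel)"
  unfolding mehler_integrand_def by measurable

lemma poisson_hermite_kernel_eq:
  "poisson_hermite_kernel t x y =
     2 / pi * t * (\<integral>s. indicator {0<..<1} s * mehler_integrand t x y s \<partial>lborel)"
  unfolding poisson_hermite_kernel_def mehler_integrand_def set_lebesgue_integral_def by simp

lemma poisson_hermite_kernel_measurable [measurable]:
  "poisson_hermite_kernel t x \<in> borel_measurable borel"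
  unfolding poisson_hermite_kernel_eq by measurable

lemma has_bochner_integral_poisson_integrand:
  assumes A: "A > 0"
  shows "has_bochner_integral lborel (\<lambda>s. indicator {0<..<1/2} s * poisson_integrand A s)
           (exp (- (A / 2)) / (2 * A))"
proof -
  \<comment> \<open>The value at \<open>0\<close> is set by hand, because \<open>A / 0 = 0\<close> would make it \<open>1 / (2 * A)\<close>.\<close>
  define F where "F s = (if s = 0 then 0 else exp (- (A / (4 * s))) / (2 * A))" for s
  have "has_bochner_integral lborel (\<lambda>s. indicator {0<..<1/2} s * poisson_integrand A s) (F (1/2) - F 0)"
  proof (rule has_bochner_integral_FTC_Ioo_nonneg)
    show "continuous_on {0..1/2} F"
      unfolding continuous_on_def
    proof
      fix s :: real assume s: "s \<in> {0..1/2}"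
      show "(F \<longlongrightarrow> F s) (at s within {0..1/2})"
      proof (cases "s = 0")
        case False
        have "((\<lambda>s. exp (- (A / (4 * s))) / (2 * A)) \<longlongrightarrow> exp (- (A / (4 * s))) / (2 * A)) (at s within {0..1/2})"
          by (intro tendsto_intros) (use False A in auto)
        moreover have "\<forall>\<^sub>F u in at s within {0..1/2}. exp (- (A / (4 * u))) / (2 * A) = F u"
          using eventually_neq_at_within[of 0 s] by eventually_elim (simp add: F_def)
        ultimately have "(F \<longlongrightarrow> exp (- (A / (4 * s))) / (2 * A)) (at s within {0..1/2})"
          by (rule Lim_transform_eventually)
        then show ?thesis using False by (simp add: F_def[of s])
      next
        case True
        have lim: "((\<lambda>s. s * (2 / A\<^sup>2)) \<longlongrightarrow> 0) (at 0 within {0..1/2})"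
          by (rule tendsto_eq_intros refl)+ simp
        have "\<forall>\<^sub>F s in at 0 within {0..1/2}. norm (F s) \<le> s * (2 / A\<^sup>2)"
          unfolding eventually_at_filter
        proof (intro always_eventually allI impI)
          fix s :: real assume "s \<noteq> 0" "s \<in> {0..1/2}"
          then have s: "s > 0" by auto
          have "A / (4 * s) \<le> exp (A / (4 * s))" using exp_ge_add_one_self[of "A / (4 * s)"] by linarith
          then have "exp (- (A / (4 * s))) \<le> 4 * s / A"
            using s A by (simp add: exp_minus field_simps)
          then have "exp (- (A / (4 * s))) / (2 * A) \<le> 4 * s / A / (2 * A)"
            using A by (intro divide_right_mono) auto
          also have "\<dots> = s * (2 / A\<^sup>2)" using A by (simp add: power2_eq_square field_simps)
          finally show "norm (F s) \<le> s * (2 / A\<^sup>2)" using s A by (simp add: F_def)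
        qed
        then have "(F \<longlongrightarrow> 0) (at 0 within {0..1/2})"
          using lim by (rule Lim_null_comparison)
        then show ?thesis using True by (simp add: F_def[of 0])
      qed
    qed
  next
    fix s :: real assume s: "0 < s" "s < 1/2"
    have "((\<lambda>s. - (A / (4 * s))) has_real_derivative A / (4 * s\<^sup>2)) (at s)"
      using s by (auto intro!: derivative_eq_intros simp: power2_eq_square)
    from DERIV_cdivide[OF DERIV_fun_exp[OF this], of "2 * A"]
    have "((\<lambda>s. exp (- (A / (4 * s))) / (2 * A)) has_real_derivative poisson_integrand A s) (at s)"
      using s A by (simp add: poisson_integrand_def)
    moreover have "\<forall>\<^sub>F u in nhds s. u \<in> {0<..}" using s by (intro eventually_nhds_in_open) auto
    then have "\<forall>\<^sub>F u in nhds s. exp (- (A / (4 * u))) / (2 * A) = F u"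
      by eventually_elim (auto simp: F_def)
    ultimately show "(F has_real_derivative poisson_integrand A s) (at s)"
      by (simp only: DERIV_cong_ev[OF refl _ refl])
    show "0 \<le> poisson_integrand A s" using A by (simp add: poisson_integrand_def)
  next
    show "poisson_integrand A \<in> borel_measurable borel"
      unfolding poisson_integrand_def by measurable
  qed simp
  then show ?thesis by (simp add: F_def)
qed

text \<open>
  The ratio \<open>h\<close> of the two integrands is a product of four factors, each of which is \<open>1 + O(s)\<close>; with
  \<open>\<rho> = 4 * s / kappa s\<close>, the two factors that involve \<open>kappa\<close> are controlled by \<open>1 - s\<^sup>2 \<le> \<rho> \<le> 1\<close>.
\<close>
lemma mehler_integrand_near_zero:
  assumes s: "0 < s" "s \<le> 1/2" and t: "0 < t" "t \<le> 1"
  shows "\<bar>mehler_integrand t x y s - poisson_integrand (t\<^sup>2 + (x - y)\<^sup>2) s\<bar> \<le>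
           (3 + (x + y)\<^sup>2) * s * poisson_integrand (t\<^sup>2 + (x - y)\<^sup>2) s"
proof -
  define \<rho> where "\<rho> = 4 * s / kappa s"
  define S where "S = (x + y)\<^sup>2 / 4"
  define h where "h = (1 - s\<^sup>2) powr (-1/2) * \<rho> powr (3/2) * exp (- (s * S)) *
    exp (t\<^sup>2 * (1 / (4 * s) - 1 / kappa s))"
  let ?q = "poisson_integrand (t\<^sup>2 + (x - y)\<^sup>2) s"
  have k: "4 * s \<le> kappa s" "kappa s \<le> 4 * s / (1 - s\<^sup>2)" using kappa_ge[of s] kappa_le[of s] s by auto
  then have k0: "kappa s > 0" using s by linarith
  have "s * s \<le> s * (1/2)" using s by (intro mult_left_mono) auto
  then have s2: "s\<^sup>2 \<le> s / 2" "0 < 1 - s\<^sup>2" "0 \<le> s\<^sup>2"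
    using s zero_le_square[of s] unfolding power2_eq_square by linarith+
  have \<rho>: "1 - s\<^sup>2 \<le> \<rho>" "\<rho> \<le> 1" "0 < \<rho>"
    using k k0 s s2 unfolding \<rho>_def
    by (simp_all add: pos_le_divide_eq pos_divide_le_eq mult.commute)
  have diff: "0 \<le> 1 / (4 * s) - 1 / kappa s" "1 / (4 * s) - 1 / kappa s \<le> s / 4"
  proof -
    have e: "1 / (4 * s) - 1 / kappa s = (1 - \<rho>) / (4 * s)"
      using s k0 by (simp add: \<rho>_def field_simps)
    show "0 \<le> 1 / (4 * s) - 1 / kappa s" unfolding e using \<rho> s by simp
    have "(1 - \<rho>) / (4 * s) \<le> s\<^sup>2 / (4 * s)" using \<rho> s by (intro divide_right_mono) auto
    then show "1 / (4 * s) - 1 / kappa s \<le> s / 4" unfolding e using s by (simp add: power2_eq_square)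
  qed
  have "kappa s powr (3/2) * \<rho> powr (3/2) = (4 * s) powr (3/2)"
    using k0 \<rho> s by (subst powr_mult[symmetric]) (auto simp: \<rho>_def)
  also have "\<dots> = 8 * (s powr (3/2))"
  proof -
    have "(4::real) powr (3/2) = (2 powr 2) powr (3/2)" by simp
    also have "\<dots> = 8" by (subst powr_powr) simp
    finally show ?thesis using s by (simp add: powr_mult)
  qed
  finally have k32: "s powr (1/2) * kappa s powr (3/2) = 8 * s\<^sup>2 / \<rho> powr (3/2)"
    using s \<rho> by (simp add: field_simps powr_add[symmetric] flip: powr_numeral)
  have "exp (- (t\<^sup>2 / kappa s)) * exp (- (1/4) * (\<bar>x - y\<bar>\<^sup>2 / s + s * \<bar>x + y\<bar>\<^sup>2)) =
      exp (- ((t\<^sup>2 + (x - y)\<^sup>2) / (4 * s))) * exp (- (s * S)) * exp (t\<^sup>2 * (1 / (4 * s) - 1 / kappa s))"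
    unfolding exp_add[symmetric] S_def using s k0 by (intro arg_cong[where f = exp]) (simp add: field_simps)
  then have eq: "mehler_integrand t x y s = ?q * h"
    unfolding mehler_integrand_def k32 poisson_integrand_def h_def by (simp add: field_simps)
  have q: "0 \<le> ?q" by (simp add: poisson_integrand_def)
  have S: "0 \<le> S" by (simp add: S_def)
  have "h \<le> (1 + s) * 1 * 1 * (1 + s)"
    unfolding h_def
  proof (intro mult_mono)
    have "(1 - s\<^sup>2) powr (-1/2) \<le> (1 - s\<^sup>2) powr (-1)"
      using s2 by (intro powr_mono') auto
    also have "\<dots> = 1 / (1 - s\<^sup>2)" using s2 by (simp add: powr_minus_divide)
    also have "\<dots> \<le> 1 + s"
    proof -
      have "s\<^sup>2 * (1 + s) \<le> s / 2 * 2" using s s2 by (intro mult_mono) auto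
      then show ?thesis using s2 by (simp add: field_simps)
    qed
    finally show "(1 - s\<^sup>2) powr (-1/2) \<le> 1 + s" .
    show "\<rho> powr (3/2) \<le> 1" using \<rho> by (intro powr_le1) auto
    show "exp (- (s * S)) \<le> 1" using s S by simp
    have "t\<^sup>2 * (1 / (4 * s) - 1 / kappa s) \<le> 1 * (s / 4)"
      using diff t by (intro mult_mono) (auto simp: abs_square_le_1)
    then have "exp (t\<^sup>2 * (1 / (4 * s) - 1 / kappa s)) \<le> exp (s / 4)" by simp
    also have "\<dots> \<le> 1 + s / 4 + (s / 4)\<^sup>2" using s by (intro exp_bound) auto
    also have "\<dots> \<le> 1 + s" using s s2 by (simp add: power_divide)
    finally show "exp (t\<^sup>2 * (1 / (4 * s) - 1 / kappa s)) \<le> 1 + s" .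
  qed (use s in auto)
  also have "\<dots> \<le> 1 + 3 * s" using s2 s by (simp add: power2_eq_square algebra_simps)
  finally have "h - 1 \<le> 3 * s" by simp
  also have "\<dots> \<le> (3 + (x + y)\<^sup>2) * s" using s by (intro mult_right_mono) auto
  finally have upper: "h - 1 \<le> (3 + (x + y)\<^sup>2) * s" .
  have "1 * (1 - s) * (1 - s * S) * 1 \<le> h" if "s * S \<le> 1"
    unfolding h_def
  proof (intro mult_mono)
    have "(1 - s\<^sup>2) powr 0 \<le> (1 - s\<^sup>2) powr (-1/2)" using s2 by (intro powr_mono') auto
    then show "1 \<le> (1 - s\<^sup>2) powr (-1/2)" using s2 by simp
    have "(1 - s\<^sup>2)\<^sup>2 = 1 - 2 * s\<^sup>2 + (s\<^sup>2)\<^sup>2" by (simp add: power2_diff)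
    then have "1 - s \<le> (1 - s\<^sup>2)\<^sup>2" using s2 zero_le_power2[of "s\<^sup>2"] by linarith
    also have "\<dots> = (1 - s\<^sup>2) powr 2" using s2 by simp
    also have "\<dots> \<le> (1 - s\<^sup>2) powr (3/2)" using s2 by (intro powr_mono') auto
    also have "\<dots> \<le> \<rho> powr (3/2)" using s2 \<rho> by (intro powr_mono2) auto
    finally show "1 - s \<le> \<rho> powr (3/2)" .
    show "1 - s * S \<le> exp (- (s * S))" using exp_ge_add_one_self[of "- (s * S)"] by simp
    show "1 \<le> exp (t\<^sup>2 * (1 / (4 * s) - 1 / kappa s))" using diff by simp
  qed (use s that in auto)
  moreover have "1 - s - s * S \<le> (1 - s) * (1 - s * S)" using s S by (simp add: algebra_simps)
  moreover have "0 \<le> h" by (simp add: h_def)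
  \<comment> \<open>If \<open>s * S > 1\<close>, the left-hand side is negative.\<close>
  ultimately have lower: "1 - s - s * S \<le> h" using s by (cases "s * S \<le> 1") auto
  have "s + s * S \<le> (3 + (x + y)\<^sup>2) * s" using s by (simp add: S_def algebra_simps)
  with upper lower have "\<bar>h - 1\<bar> \<le> (3 + (x + y)\<^sup>2) * s" by linarith
  then have "?q * \<bar>h - 1\<bar> \<le> ?q * ((3 + (x + y)\<^sup>2) * s)" using q by (intro mult_left_mono)
  moreover have "?q * h - ?q = ?q * (h - 1)" by (simp add: algebra_simps)
  then have "\<bar>?q * h - ?q\<bar> = ?q * \<bar>h - 1\<bar>" using q by (simp add: abs_mult)
  ultimately show ?thesis unfolding eq by (simp add: mult.commute)
qed

text \<open>
  From \<open>exp (- w) \<le> w powr (-1/4)\<close> with \<open>w = t\<^sup>2 / (4 * s)\<close>.  The exponent \<open>1/4\<close> is a compromise: any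
  exponent strictly between \<open>0\<close> and \<open>1/2\<close> makes the bound integrable in \<open>s\<close> and leaves a positive
  power of \<open>t\<close> after multiplication by the prefactor \<open>t\<close> of the kernel.
\<close>
lemma poisson_integrand_bound:
  assumes "0 < s" "0 < t"
  shows "s * poisson_integrand (t\<^sup>2 + r\<^sup>2) s \<le> s powr (-3/4) / sqrt t"
proof -
  define w where "w = t\<^sup>2 / (4 * s)"
  have w: "w > 0" using assms by (simp add: w_def)
  have "w powr (1/4) \<le> exp w"
  proof -
    have "w powr (1/4) = exp (ln w / 4)" using w by (simp add: powr_def)
    also have "\<dots> \<le> exp w" using ln_le_minus_one[OF w] w by (simp add: field_simps)
    finally show ?thesis .
  qed
  then have "exp (- w) \<le> 1 / w powr (1/4)" using w by (simp add: exp_minus field_simps)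
  also have "w powr (1/4) = sqrt t / (4 * s) powr (1/4)"
    using assms by (simp add: w_def powr_divide powr_half_sqrt[symmetric] powr_powr flip: powr_numeral)
  also have "1 / (sqrt t / (4 * s) powr (1/4)) = (4 * s) powr (1/4) / sqrt t" by simp
  also have "(4 * s) powr (1/4) \<le> 8 * s powr (1/4)"
  proof -
    have "(4::real) powr (1/4) \<le> 4 powr 1" by (intro powr_mono) auto
    then show ?thesis using assms by (simp add: powr_mult mult_right_mono)
  qed
  finally have e: "exp (- w) \<le> 8 * s powr (1/4) / sqrt t" using assms by (simp add: divide_right_mono)
  have "s * poisson_integrand (t\<^sup>2 + r\<^sup>2) s = exp (- ((t\<^sup>2 + r\<^sup>2) / (4 * s))) / (8 * s)"
    using assms by (simp add: poisson_integrand_def power2_eq_square)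
  also have "\<dots> \<le> exp (- w) / (8 * s)"
    using assms by (intro divide_right_mono) (auto simp: w_def divide_right_mono)
  also have "\<dots> \<le> (8 * s powr (1/4) / sqrt t) / (8 * s)"
    using assms e by (intro divide_right_mono) auto
  also have "\<dots> = (s powr (1/4) / s) / sqrt t" by simp
  also have "s powr (1/4) / s = s powr (-3/4)"
    using assms powr_diff[of s "1/4" 1] by simp
  finally show ?thesis .
qed

lemma mehler_integrand_away_from_zero:
  assumes s: "1/2 \<le> s" "s < 1"
  shows "mehler_integrand t x y s \<le> (1 - s) powr (-1/2)"
proof -
  have k: "4 * s \<le> kappa s" using kappa_ge[of s] s by auto
  have "1 / 2 = (1/4::real) powr (1/2)" by (simp add: powr_half_sqrt real_sqrt_divide)
  also have "\<dots> \<le> s powr (1/2)" using s by (intro powr_mono2) auto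
  finally have a: "1/2 \<le> s powr (1/2)" .
  have "2 = 2 powr (1::real)" by simp
  also have "\<dots> \<le> 2 powr (3/2)" by (intro powr_mono) auto
  also have "\<dots> \<le> kappa s powr (3/2)" using s k by (intro powr_mono2) auto
  finally have b: "2 \<le> kappa s powr (3/2)" .
  have den: "1 \<le> s powr (1/2) * kappa s powr (3/2)" using mult_mono[OF a b] by simp
  have "mehler_integrand t x y s \<le> (1 * (1 - s) powr (-1/2) * 1) / 1"
    unfolding mehler_integrand_def
  proof (intro frac_le mult_mono)
    show "exp (- (t\<^sup>2 / kappa s)) \<le> 1" using k s by simp
    have "1 - s \<le> 1 - s\<^sup>2" using s by (simp add: power2_eq_square)
    then show "(1 - s\<^sup>2) powr (-1/2) \<le> (1 - s) powr (-1/2)" using s by (intro powr_mono2') auto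
    show "exp (- (1/4) * (\<bar>x - y\<bar>\<^sup>2 / s + s * \<bar>x + y\<bar>\<^sup>2)) \<le> 1" using s by simp
  qed (use den in auto)
  then show ?thesis by simp
qed

lemma mehler_integrand_nonneg: "0 \<le> mehler_integrand t x y s"
  unfolding mehler_integrand_def by simp

lemma has_bochner_integral_powr_unit:
  "has_bochner_integral lborel (\<lambda>s::real. indicator {0<..<1} s * s powr (-3/4)) 4"
  "has_bochner_integral lborel (\<lambda>s::real. indicator {0<..<1} s * (1 - s) powr (-1/2)) 2"
proof -
  have "has_bochner_integral lborel (\<lambda>s::real. indicator {0<..<1} s * s powr (-3/4))
      (4 * 1 powr (1/4) - 4 * 0 powr (1/4))"
    by (rule has_bochner_integral_FTC_Ioo_nonneg[where F = "\<lambda>s. 4 * s powr (1/4)"])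
       (auto intro!: derivative_eq_intros continuous_on_mult continuous_on_powr' continuous_on_id
          continuous_on_const)
  then show "has_bochner_integral lborel (\<lambda>s::real. indicator {0<..<1} s * s powr (-3/4)) 4" by simp
  have "has_bochner_integral lborel (\<lambda>s::real. indicator {0<..<1} s * (1 - s) powr (-1/2))
      (- 2 * (1 - 1) powr (1/2) - (- 2 * (1 - 0) powr (1/2)))"
    by (rule has_bochner_integral_FTC_Ioo_nonneg[where F = "\<lambda>s. - 2 * (1 - s) powr (1/2)"])
       (auto intro!: derivative_eq_intros continuous_on_mult continuous_on_powr' continuous_on_diff
          continuous_on_minus continuous_on_id continuous_on_const)
  then show "has_bochner_integral lborel (\<lambda>s::real. indicator {0<..<1} s * (1 - s) powr (-1/2)) 2"
    by simp
qed

text \<open>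
  On \<open>{0<..<1/2}\<close> the integrands are compared; the integral over \<open>{1/2..<1}\<close> is bounded and so
  contributes \<open>O(t)\<close>, and so does the part \<open>s > 1/2\<close> missing from the subordination formula for \<open>p\<close>.
\<close>
lemma poisson_hermite_kernel_near:
  assumes t: "0 < t" "t \<le> 1" and xy: "\<bar>x\<bar> \<le> m" "\<bar>y\<bar> \<le> m"
  shows "\<bar>poisson_hermite_kernel t x y - poisson_kernel t (x - y)\<bar> \<le> (15 + 16 * m\<^sup>2) * sqrt t"
proof -
  define A where "A = t\<^sup>2 + (x - y)\<^sup>2"
  define C where "C = 3 + 4 * m\<^sup>2"
  have A: "A > 0" using t by (simp add: A_def add_pos_nonneg)
  have C: "0 \<le> C" by (simp add: C_def)
  have "\<bar>x + y\<bar> \<le> 2 * m" using xy by linarith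
  then have "(x + y)\<^sup>2 \<le> (2 * m)\<^sup>2" by (metis abs_ge_zero power2_abs power_mono)
  then have xyC: "3 + (x + y)\<^sup>2 \<le> C" by (simp add: C_def power_mult_distrib)
  let ?k = "\<lambda>s. indicator {0<..<1} s * mehler_integrand t x y s"
  let ?q = "\<lambda>s. indicator {0<..<1/2} s * poisson_integrand A s"
  let ?d = "\<lambda>s. C / sqrt t * (indicator {0<..<1} s * s powr (-3/4)) +
    indicator {0<..<1} s * (1 - s) powr (-1/2)"
  have d: "has_bochner_integral lborel ?d (C / sqrt t * 4 + 2)"
    by (intro has_bochner_integral_add has_bochner_integral_mult_right has_bochner_integral_powr_unit)
  have q: "has_bochner_integral lborel ?q (exp (- (A / 2)) / (2 * A))"
    by (rule has_bochner_integral_poisson_integrand[OF A])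
  have le: "\<bar>?k s - ?q s\<bar> \<le> ?d s" for s
  proof -
    consider "s \<notin> {0<..<1}" | "0 < s" "s < 1/2" | "1/2 \<le> s" "s < 1" by force
    then show ?thesis
    proof cases
      case 1
      then have "s \<notin> {0<..<1/2}" by auto
      with 1 show ?thesis by simp
    next
      case 2
      have "\<bar>mehler_integrand t x y s - poisson_integrand A s\<bar> \<le>
          (3 + (x + y)\<^sup>2) * (s * poisson_integrand A s)"
        unfolding A_def using mehler_integrand_near_zero[of s t x y] 2 t by (simp add: mult.assoc)
      also have "\<dots> \<le> C * (s powr (-3/4) / sqrt t)"
        unfolding A_def using 2 t xyC C
        by (intro mult_mono poisson_integrand_bound) (auto simp: poisson_integrand_def)
      finally have "\<bar>mehler_integrand t x y s - poisson_integrand A s\<bar> \<le> C / sqrt t * s powr (-3/4)"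
        by simp
      moreover have "0 \<le> (1 - s) powr (-1/2)" by simp
      ultimately show ?thesis
        using 2 by (simp only: indicator_simps greaterThanLessThan_iff) (simp add: add_increasing2)
    next
      case 3
      have "0 \<le> C / sqrt t * s powr (-3/4)" using C t by simp
      with 3 show ?thesis
        using mehler_integrand_away_from_zero[of s t x y] mehler_integrand_nonneg[of t x y s] by simp
    qed
  qed
  have kq: "integrable lborel (\<lambda>s. ?k s - ?q s)"
  proof (rule Bochner_Integration.integrable_bound)
    show "integrable lborel ?d" using d by (simp add: has_bochner_integral_iff)
    show "AE s in lborel. norm (?k s - ?q s) \<le> norm (?d s)"
      unfolding real_norm_def by (intro AE_I2 order_trans[OF le abs_ge_self])
    show "(\<lambda>s. ?k s - ?q s) \<in> borel_measurable lborel"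
      unfolding poisson_integrand_def by measurable
  qed
  have "\<bar>(\<integral>s. ?k s - ?q s \<partial>lborel)\<bar> \<le> (\<integral>s. ?d s \<partial>lborel)"
    using kq d le by (intro integral_abs_bound_integral) (auto simp: has_bochner_integral_iff)
  then have dle: "\<bar>(\<integral>s. ?k s - ?q s \<partial>lborel)\<bar> \<le> C / sqrt t * 4 + 2"
    using d by (simp add: has_bochner_integral_iff)
  have "integrable lborel ?k"
    using Bochner_Integration.integrable_add[OF kq] q by (force simp: has_bochner_integral_iff)
  then have k: "(\<integral>s. ?k s \<partial>lborel) = (\<integral>s. ?k s - ?q s \<partial>lborel) + exp (- (A / 2)) / (2 * A)"
    using q by (simp add: has_bochner_integral_iff)
  define I where "I = (\<integral>s. ?k s - ?q s \<partial>lborel)"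
  have "poisson_hermite_kernel t x y = 2 / pi * t * I + t * exp (- (A / 2)) / (pi * A)"
    unfolding poisson_hermite_kernel_eq k I_def using A by (simp add: field_simps)
  then have "poisson_hermite_kernel t x y - poisson_kernel t (x - y) =
      2 / pi * t * I - t / (pi * A) * (1 - exp (- (A / 2)))"
    by (simp add: poisson_kernel_def A_def[symmetric] algebra_simps)
  also have "\<bar>\<dots>\<bar> \<le> 2 / pi * t * \<bar>I\<bar> + t / (pi * A) * (1 - exp (- (A / 2)))"
    using t A by (intro order_trans[OF abs_triangle_ineq4]) (auto simp: abs_mult)
  also have "\<dots> \<le> 1 * t * (C / sqrt t * 4 + 2) + t / (pi * A) * (A / 2)"
  proof (intro add_mono mult_mono order_refl)
    show "2 / pi \<le> 1" using pi_ge_two by simp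
    show "\<bar>I\<bar> \<le> C / sqrt t * 4 + 2" using dle by (simp add: I_def)
    show "1 - exp (- (A / 2)) \<le> A / 2" using exp_ge_add_one_self[of "- (A / 2)"] by simp
  qed (use t A in auto)
  also have "\<dots> = 4 * C * (t / sqrt t) + (2 + 1 / (2 * pi)) * t" using A by (simp add: field_simps)
  also have "t / sqrt t = sqrt t" using t by (simp add: real_div_sqrt)
  also have "(2 + 1 / (2 * pi)) * t \<le> 3 * sqrt t"
  proof (intro mult_mono)
    show "2 + 1 / (2 * pi) \<le> 3" using pi_ge_two by (simp add: field_simps)
    have "sqrt t * sqrt t \<le> sqrt t * 1" using t by (intro mult_left_mono) auto
    then show "t \<le> sqrt t" using t by simp
  qed (use t in auto)
  finally show ?thesis by (simp add: C_def algebra_simps)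
qed

section \<open>Decay of the Poisson--Hermite kernel\<close>

text \<open>
  At \<open>s = 1\<close> the exponent equals \<open>(x\<^sup>2 + y\<^sup>2) / 2\<close>.  After \<open>y\<^sup>2 / 2\<close> is subtracted, the remaining terms in
  \<open>y\<close> carry a factor \<open>1 - s\<close>, which is why \<open>y\<close> enters only through \<open>(1 - s) * \<bar>y\<bar>\<close>; the terms in \<open>x\<^sup>2\<close>
  are nonnegative.
\<close>
lemma mehler_exponent_lower_bound:
  fixes x y s m :: real
  assumes s: "0 < s" "s < 1" and x: "\<bar>x\<bar> \<le> m"
  shows "y\<^sup>2 / 2 + (((1 - s) * \<bar>y\<bar>)\<^sup>2 - 4 * m * ((1 - s) * \<bar>y\<bar>)) / (4 * s) \<le>
           1/4 * (\<bar>x - y\<bar>\<^sup>2 / s + s * \<bar>x + y\<bar>\<^sup>2)"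
proof -
  have "x * y \<le> \<bar>x\<bar> * \<bar>y\<bar>" by (metis abs_ge_self abs_mult)
  also have "\<dots> \<le> m * \<bar>y\<bar>" using x by (intro mult_right_mono) auto
  finally have "x * y \<le> m * \<bar>y\<bar>" .
  moreover have "(1 - s) * (1 + s) \<le> (1 - s) * 2" using s by (intro mult_left_mono) auto
  moreover have "0 \<le> m" using x by linarith
  ultimately have "2 * (x * y) * ((1 - s) * (1 + s)) \<le> 2 * (m * \<bar>y\<bar>) * ((1 - s) * 2)"
    using s by (intro mult_mono[of "2 * (x * y)" "2 * (m * \<bar>y\<bar>)" "(1 - s) * (1 + s)" "(1 - s) * 2"]) auto
  then have "2 * (x * y) * ((1 - s) * (1 + s)) \<le> 4 * m * ((1 - s) * \<bar>y\<bar>)" by (simp add: mult_ac)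
  moreover have "((1 - s) * \<bar>y\<bar>)\<^sup>2 = (1 - s)\<^sup>2 * y\<^sup>2" by (simp add: power_mult_distrib)
  moreover have "(x - y)\<^sup>2 + s\<^sup>2 * (x + y)\<^sup>2 =
      2 * s * y\<^sup>2 + (1 - s)\<^sup>2 * y\<^sup>2 + (1 + s\<^sup>2) * x\<^sup>2 - 2 * (x * y) * ((1 - s) * (1 + s))"
    by (simp add: power2_eq_square algebra_simps)
  moreover have "0 \<le> (1 + s\<^sup>2) * x\<^sup>2" by simp
  ultimately have "2 * s * y\<^sup>2 + (((1 - s) * \<bar>y\<bar>)\<^sup>2 - 4 * m * ((1 - s) * \<bar>y\<bar>)) \<le>
      (x - y)\<^sup>2 + s\<^sup>2 * (x + y)\<^sup>2"
    by linarith
  then have "(2 * s * y\<^sup>2 + (((1 - s) * \<bar>y\<bar>)\<^sup>2 - 4 * m * ((1 - s) * \<bar>y\<bar>))) / (4 * s) \<le>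
      ((x - y)\<^sup>2 + s\<^sup>2 * (x + y)\<^sup>2) / (4 * s)"
    using s by (intro divide_right_mono) auto
  also have "\<dots> = 1/4 * (\<bar>x - y\<bar>\<^sup>2 / s + s * \<bar>x + y\<bar>\<^sup>2)"
    using s by (simp add: add_divide_distrib power2_eq_square)
  also have "(2 * s * y\<^sup>2 + (((1 - s) * \<bar>y\<bar>)\<^sup>2 - 4 * m * ((1 - s) * \<bar>y\<bar>))) / (4 * s) =
      y\<^sup>2 / 2 + (((1 - s) * \<bar>y\<bar>)\<^sup>2 - 4 * m * ((1 - s) * \<bar>y\<bar>)) / (4 * s)"
    using s by (simp add: add_divide_distrib)
  finally show ?thesis .
qed

lemma exp_ge_half_square: "0 \<le> w \<Longrightarrow> w\<^sup>2 / 2 \<le> exp (w::real)"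
  using exp_lower_Taylor_quadratic[of w] by linarith

text \<open>
  For \<open>s \<le> 1/2\<close> the quantity \<open>v = (1 - s) * \<bar>y\<bar>\<close> is at least \<open>8 * m\<close>, so the quadratic term wins over
  the linear one and the exponent gains \<open>y\<^sup>2 / (32 * s)\<close>.  This compensates the singularity at \<open>s = 0\<close>
  and leaves more decay in \<open>y\<close> than is required.
\<close>
lemma mehler_integrand_far_left:
  assumes s: "0 < s" "s \<le> 1/2" and x: "\<bar>x\<bar> \<le> m" and y: "16 * m \<le> \<bar>y\<bar>" "1 \<le> \<bar>y\<bar>"
  shows "mehler_integrand t x y s \<le> exp (- (y\<^sup>2 / 2)) * (512 / \<bar>y\<bar> ^ 4)"
proof -
  define v where "v = (1 - s) * \<bar>y\<bar>"
  define w where "w = y\<^sup>2 / (32 * s)"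
  have k: "4 * s \<le> kappa s" using kappa_ge[of s] s by auto
  have v: "\<bar>y\<bar> / 2 \<le> v" unfolding v_def using mult_right_mono[of "1/2" "1 - s" "\<bar>y\<bar>"] s by simp
  have "v * (v / 2) \<le> v * (v - 4 * m)" using v y by (intro mult_left_mono) auto
  moreover have "(\<bar>y\<bar> / 2)\<^sup>2 \<le> v\<^sup>2" using v by (intro power_mono) auto
  ultimately have "y\<^sup>2 / 8 \<le> v\<^sup>2 - 4 * m * v" by (simp add: power2_eq_square algebra_simps)
  then have "y\<^sup>2 / 8 / (4 * s) \<le> (v\<^sup>2 - 4 * m * v) / (4 * s)" using s by (intro divide_right_mono) auto
  moreover have "y\<^sup>2 / 8 / (4 * s) = w" by (simp add: w_def)
  moreover have "y\<^sup>2 / 2 + (v\<^sup>2 - 4 * m * v) / (4 * s) \<le> 1/4 * (\<bar>x - y\<bar>\<^sup>2 / s + s * \<bar>x + y\<bar>\<^sup>2)"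
    unfolding v_def using s x by (intro mehler_exponent_lower_bound) auto
  ultimately have "y\<^sup>2 / 2 + w \<le> 1/4 * (\<bar>x - y\<bar>\<^sup>2 / s + s * \<bar>x + y\<bar>\<^sup>2)" by linarith
  then have "exp (- (1/4) * (\<bar>x - y\<bar>\<^sup>2 / s + s * \<bar>x + y\<bar>\<^sup>2)) \<le> exp (- (y\<^sup>2 / 2)) * exp (- w)"
    unfolding exp_add[symmetric] exp_le_cancel_iff by linarith
  also have "exp (- w) \<le> 2 / w\<^sup>2"
  proof -
    have "w > 0" using s y by (auto simp: w_def)
    then show ?thesis using exp_ge_half_square[of w] by (simp add: exp_minus field_simps)
  qed
  also have "2 / w\<^sup>2 = 2048 * s\<^sup>2 / \<bar>y\<bar> ^ 4"
    using s y by (simp add: w_def power_divide power_mult_distrib flip: power_mult)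
  finally have E: "exp (- (1/4) * (\<bar>x - y\<bar>\<^sup>2 / s + s * \<bar>x + y\<bar>\<^sup>2)) \<le>
      exp (- (y\<^sup>2 / 2)) * (2048 * s\<^sup>2 / \<bar>y\<bar> ^ 4)" by simp
  have D: "8 * s\<^sup>2 \<le> s powr (1/2) * kappa s powr (3/2)"
  proof -
    have "(4::real) powr (3/2) = (2 powr 2) powr (3/2)" by simp
    also have "\<dots> = 8" by (subst powr_powr) simp
    finally have "8 * s\<^sup>2 = s powr (1/2) * (4 * s) powr (3/2)"
      using s by (simp add: powr_mult powr_add[symmetric] flip: powr_numeral)
    also have "\<dots> \<le> s powr (1/2) * kappa s powr (3/2)"
      using s k by (intro mult_left_mono powr_mono2) auto
    finally show ?thesis .
  qed
  have P: "(1 - s\<^sup>2) powr (-1/2) \<le> 2"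
  proof -
    have "s * s \<le> 1/2 * (1/2)" using s by (intro mult_mono) auto
    then have "(1 - s\<^sup>2) powr (-1/2) \<le> (1/4) powr (-1/2)"
      by (intro powr_mono2') (auto simp: power2_eq_square)
    also have "\<dots> = 2" by (simp add: powr_minus_divide powr_half_sqrt real_sqrt_divide)
    finally show ?thesis .
  qed
  have "mehler_integrand t x y s \<le> (1 * 2 * (exp (- (y\<^sup>2 / 2)) * (2048 * s\<^sup>2 / \<bar>y\<bar> ^ 4))) / (8 * s\<^sup>2)"
    unfolding mehler_integrand_def
    by (intro frac_le mult_mono E P D) (use s k in auto)
  also have "\<dots> = exp (- (y\<^sup>2 / 2)) * (512 / \<bar>y\<bar> ^ 4)" using s by simp
  finally show ?thesis .
qed

lemma ln_exp1_add_le: "0 \<le> v \<Longrightarrow> ln (exp 1 + v) \<le> 1 + (v::real)"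
proof -
  assume v: "0 \<le> v"
  have "exp 1 + v \<le> exp 1 * exp v"
  proof -
    have "exp 1 * (1 + v) \<le> exp 1 * exp v" by (intro mult_left_mono exp_ge_add_one_self) auto
    moreover have "1 * v \<le> exp 1 * v" using v by (intro mult_right_mono) auto
    ultimately show ?thesis by (simp add: algebra_simps)
  qed
  then have "ln (exp 1 + v) \<le> ln (exp (1 + v))" using v by (intro ln_mono) (auto simp: exp_add add_pos_nonneg)
  then show ?thesis by simp
qed

text \<open>
  With \<open>u = 1 - s\<close> the numbers \<open>kappa s\<close> and \<open>ln (1 / u)\<close> are comparable.  The inequality
  \<open>exp 1 + Y \<le> (exp 1 + u * Y) / u\<close> shows that \<open>ln (exp 1 + Y)\<close> exceeds \<open>ln (1 / u)\<close> by at most a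
  function of \<open>u * Y\<close>, and such functions are absorbed by the Gaussian in \<open>u * Y\<close>.
\<close>
lemma kappa_ge_log:
  assumes s: "1/2 < s" "s < 1" and Y: "0 \<le> Y"
  shows "2 / 3 * ln (exp 1 + Y) / (1 + (1 - s) * Y) \<le> kappa s"
proof -
  define u where "u = 1 - s"
  have u: "0 < u" "u < 1/2" using s by (auto simp: u_def)
  have "ln 2 \<le> ln (1 / u)" using u by (intro ln_mono) (auto simp: field_simps)
  then have lu: "1/2 \<le> ln (1 / u)" using ln2_ge_two_thirds by linarith
  have "exp 1 + Y \<le> (exp 1 + u * Y) / u"
    using u mult_right_mono[of u 1 "exp (1::real)"] by (simp add: field_simps)
  then have "ln (exp 1 + Y) \<le> ln ((exp 1 + u * Y) / u)"
    using Y by (intro ln_mono) (auto simp: add_pos_nonneg)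
  also have "\<dots> = ln (exp 1 + u * Y) + ln (1 / u)"
  proof -
    have "0 < exp 1 + u * Y" using u Y by (intro add_pos_nonneg) auto
    then show ?thesis using u by (simp add: ln_div)
  qed
  also have "\<dots> \<le> (1 + u * Y) + ln (1 / u)" using u Y by (intro add_right_mono ln_exp1_add_le) auto
  also have "\<dots> \<le> 2 * ((1 + u * Y) * ln (1 / u)) + (1 + u * Y) * ln (1 / u)"
  proof (intro add_mono)
    have "(1 + u * Y) * (1/2) \<le> (1 + u * Y) * ln (1 / u)"
      using u Y lu by (intro mult_left_mono) auto
    then show "1 + u * Y \<le> 2 * ((1 + u * Y) * ln (1 / u))" by simp
    show "ln (1 / u) \<le> (1 + u * Y) * ln (1 / u)"
      using u Y lu mult_right_mono[of 1 "1 + u * Y" "ln (1 / u)"] by simp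
  qed
  finally have le: "2 / 3 * ln (exp 1 + Y) \<le> (2 * ln (1 / u)) * (1 + u * Y)" by (simp add: algebra_simps)
  have "0 < 1 + u * Y" using u Y by (intro add_pos_nonneg) auto
  with le have "2 / 3 * ln (exp 1 + Y) / (1 + u * Y) \<le> 2 * ln (1 / u)"
    by (simp only: pos_divide_le_eq)
  also have "\<dots> \<le> kappa s"
    unfolding kappa_def using s by (intro mult_left_mono ln_mono) (auto simp: u_def divide_right_mono)
  finally show ?thesis by (simp add: u_def)
qed

text \<open>
  The Gaussian \<open>exp (- (v\<^sup>2 / 8))\<close> in \<open>v = (1 - s) * \<bar>y\<bar>\<close> is traded for \<open>(1 + v) powr (-3)\<close>: one half of
  this pays for the loss in \<open>kappa_ge_log\<close>, and the other half yields a profile with an elementary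
  antiderivative.
\<close>
lemma mehler_integrand_far_right:
  assumes s: "1/2 < s" "s < 1" and x: "\<bar>x\<bar> \<le> m"
  shows "mehler_integrand t x y s \<le> exp (- (y\<^sup>2 / 2)) * (8192 * exp (4 * m\<^sup>2) *
           ln (exp 1 + \<bar>y\<bar>) powr (-3/2) * ((1 - s) powr (-1/2) * (1 + (1 - s) * \<bar>y\<bar>) powr (-3/2)))"
proof -
  define v where "v = (1 - s) * \<bar>y\<bar>"
  define L where "L = ln (exp 1 + \<bar>y\<bar>)"
  have v: "0 \<le> v" using s by (simp add: v_def)
  have L: "0 < L" unfolding L_def by (intro ln_gt_zero) (simp add: add_strict_increasing2 add.commute)
  have k: "4 * s \<le> kappa s" using kappa_ge[of s] s by auto
  have "v\<^sup>2 / 8 - 4 * m\<^sup>2 \<le> (v\<^sup>2 - 4 * m * v) / (4 * s)"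
  proof -
    have "0 \<le> (v - 4 * m)\<^sup>2" by simp
    then have "v\<^sup>2 / 2 - 8 * m\<^sup>2 \<le> v\<^sup>2 - 4 * m * v" by (simp add: power2_eq_square algebra_simps)
    then have "(v\<^sup>2 / 2 - 8 * m\<^sup>2) / (4 * s) \<le> (v\<^sup>2 - 4 * m * v) / (4 * s)"
      using s by (intro divide_right_mono) auto
    moreover have "v\<^sup>2 / 8 \<le> v\<^sup>2 / (8 * s)" "8 * m\<^sup>2 / (4 * s) \<le> 4 * m\<^sup>2"
      using s mult_right_mono[of s 1 "v\<^sup>2"] mult_right_mono[of "1/2" s "m\<^sup>2"] by (auto simp: field_simps)
    ultimately show ?thesis by (simp add: diff_divide_distrib)
  qed
  moreover have "y\<^sup>2 / 2 + (v\<^sup>2 - 4 * m * v) / (4 * s) \<le> 1/4 * (\<bar>x - y\<bar>\<^sup>2 / s + s * \<bar>x + y\<bar>\<^sup>2)"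
    unfolding v_def using s x by (intro mehler_exponent_lower_bound) auto
  ultimately have "y\<^sup>2 / 2 + v\<^sup>2 / 8 - 4 * m\<^sup>2 \<le> 1/4 * (\<bar>x - y\<bar>\<^sup>2 / s + s * \<bar>x + y\<bar>\<^sup>2)"
    by linarith
  then have "exp (- (1/4) * (\<bar>x - y\<bar>\<^sup>2 / s + s * \<bar>x + y\<bar>\<^sup>2)) \<le>
      exp (- (y\<^sup>2 / 2)) * exp (4 * m\<^sup>2) * exp (- (v\<^sup>2 / 8))"
    unfolding exp_add[symmetric] exp_le_cancel_iff by linarith
  also have "exp (- (v\<^sup>2 / 8)) \<le> 1024 / (1 + v) ^ 3"
  proof -
    have "(1 + v) ^ 3 \<le> 1024 * exp (v\<^sup>2 / 8)"
    proof (cases "v \<le> 1")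
      case True
      have "(1 + v) ^ 3 \<le> 2 ^ 3" using v True by (intro power_mono) auto
      also have "\<dots> \<le> 1024 * 1" by simp
      also have "\<dots> \<le> 1024 * exp (v\<^sup>2 / 8)" by (intro mult_left_mono) auto
      finally show ?thesis .
    next
      case False
      have "(1 + v) ^ 3 \<le> (2 * v) ^ 3" using False by (intro power_mono) auto
      also have "\<dots> \<le> 8 * v ^ 4"
        using False power_increasing[of 3 4 v] by (simp add: power_mult_distrib)
      also have "\<dots> = 1024 * ((v\<^sup>2 / 8)\<^sup>2 / 2)" by (simp add: power_divide flip: power_mult)
      also have "\<dots> \<le> 1024 * exp (v\<^sup>2 / 8)" by (intro mult_left_mono exp_ge_half_square) auto
      finally show ?thesis .
    qed
    then show ?thesis using v by (simp add: exp_minus field_simps)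
  qed
  finally have E: "exp (- (1/4) * (\<bar>x - y\<bar>\<^sup>2 / s + s * \<bar>x + y\<bar>\<^sup>2)) \<le>
      exp (- (y\<^sup>2 / 2)) * exp (4 * m\<^sup>2) * (1024 / (1 + v) ^ 3)" by simp
  have P: "(1 - s\<^sup>2) powr (-1/2) \<le> (1 - s) powr (-1/2)"
  proof -
    have "1 - s \<le> 1 - s\<^sup>2" using s by (simp add: power2_eq_square)
    then show ?thesis using s by (intro powr_mono2') auto
  qed
  have D: "1/8 * (L powr (3/2) / (1 + v) powr (3/2)) \<le> s powr (1/2) * kappa s powr (3/2)"
  proof -
    have "1/2 \<le> s powr (1/2)"
    proof -
      have "1 / 2 = (1/4::real) powr (1/2)" by (simp add: powr_half_sqrt real_sqrt_divide)
      also have "\<dots> \<le> s powr (1/2)" using s by (intro powr_mono2) auto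
      finally show ?thesis .
    qed
    moreover have "1/4 * (L powr (3/2) / (1 + v) powr (3/2)) \<le> kappa s powr (3/2)"
    proof -
      have "1/4 = (1/4::real) powr 1" by simp
      also have "\<dots> \<le> (2/3) powr 2" by (simp add: power2_eq_square)
      also have "\<dots> \<le> (2/3) powr (3/2)" by (intro powr_mono') auto
      finally have "1/4 * (L powr (3/2) / (1 + v) powr (3/2)) \<le>
          (2/3) powr (3/2) * (L powr (3/2) / (1 + v) powr (3/2))"
        by (intro mult_right_mono) auto
      also have "\<dots> = (2 / 3 * L / (1 + v)) powr (3/2)"
        using v L by (simp only: powr_mult powr_divide times_divide_eq_right)
      also have "\<dots> \<le> kappa s powr (3/2)"
        using kappa_ge_log[of s "\<bar>y\<bar>"] s v L by (intro powr_mono2) (auto simp: L_def v_def)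
      finally show ?thesis .
    qed
    ultimately have "1/2 * (1/4 * (L powr (3/2) / (1 + v) powr (3/2))) \<le>
        s powr (1/2) * kappa s powr (3/2)"
      by (intro mult_mono) auto
    then show ?thesis by simp
  qed
  have "mehler_integrand t x y s \<le>
      (1 * (1 - s) powr (-1/2) * (exp (- (y\<^sup>2 / 2)) * exp (4 * m\<^sup>2) * (1024 / (1 + v) ^ 3))) /
        (1/8 * (L powr (3/2) / (1 + v) powr (3/2)))"
    unfolding mehler_integrand_def
    by (intro frac_le mult_mono E P D) (use s k v L in auto)
  also have "\<dots> = exp (- (y\<^sup>2 / 2)) * (8192 * exp (4 * m\<^sup>2) *
           L powr (-3/2) * ((1 - s) powr (-1/2) * ((1 + v) powr (3/2) / (1 + v) ^ 3)))"
    using v L by (simp add: powr_minus_divide field_simps)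
  also have "(1 + v) powr (3/2) / (1 + v) ^ 3 = (1 + v) powr (-3/2)"
    using v powr_diff[of "1 + v" "3/2" 3] by simp
  finally show ?thesis by (simp add: L_def v_def)
qed

text \<open>
  The antiderivative is a constant multiple of \<open>sqrt (u / (1 + u * Y))\<close> with \<open>u = 1 - s\<close>.
\<close>
lemma has_bochner_integral_far_profile:
  fixes Y :: real
  assumes Y: "0 \<le> Y"
  shows "has_bochner_integral lborel
           (\<lambda>s. indicator {0<..<1} s * ((1 - s) powr (-1/2) * (1 + (1 - s) * Y) powr (-3/2)))
           (2 * (1 + Y) powr (-1/2))"
proof -
  let ?F = "\<lambda>s::real. - 2 * (1 - s) powr (1/2) * (1 + (1 - s) * Y) powr (-1/2)"
  have "has_bochner_integral lborel
      (\<lambda>s. indicator {0<..<1} s * ((1 - s) powr (-1/2) * (1 + (1 - s) * Y) powr (-3/2)))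
      (?F 1 - ?F 0)"
  proof (rule has_bochner_integral_FTC_Ioo_nonneg)
    have pos: "1 + (1 - s) * Y > 0" if "s \<le> 1" for s
      using Y that by (intro add_pos_nonneg mult_nonneg_nonneg) auto
    show "continuous_on {0..1} ?F"
    proof (intro continuous_on_mult continuous_on_const)
      show "continuous_on {0..1} (\<lambda>s::real. (1 - s) powr (1/2))"
        by (intro continuous_on_powr' continuous_on_diff continuous_on_const continuous_on_id) auto
      show "continuous_on {0..1} (\<lambda>s. (1 + (1 - s) * Y) powr (-1/2))"
        using pos by (intro continuous_on_powr continuous_intros) (force simp: less_imp_neq)+
    qed
    fix s :: real assume s: "0 < s" "s < 1"
    define u where "u = 1 - s"
    define B where "B = 1 + u * Y"
    have u: "u > 0" and B: "B > 0" using s pos[of s] by (auto simp: u_def B_def)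
    have d1: "((\<lambda>s. (1 - s) powr (1/2)) has_real_derivative - (1/2 * u powr (-1/2))) (at s)"
      using s by (auto intro!: derivative_eq_intros simp: u_def)
    have d2: "((\<lambda>s. (1 + (1 - s) * Y) powr (-1/2)) has_real_derivative 1/2 * B powr (-3/2) * Y) (at s)"
      using s pos[of s] by (auto intro!: derivative_eq_intros simp: B_def u_def)
    have "(?F has_real_derivative - 2 * (- (1/2 * u powr (-1/2)) * B powr (-1/2) +
        1/2 * B powr (-3/2) * Y * u powr (1/2))) (at s)"
      using DERIV_cmult[OF DERIV_mult[OF d1 d2], of "- 2"] by (simp add: B_def u_def mult.assoc)
    also have "- 2 * (- (1/2 * u powr (-1/2)) * B powr (-1/2) + 1/2 * B powr (-3/2) * Y * u powr (1/2)) =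
        u powr (-1/2) * B powr (-3/2)"
    proof -
      have "B powr (-1/2) = B powr (-3/2) * B" using B powr_add[of B "-3/2" 1] by simp
      moreover have "u powr (1/2) = u powr (-1/2) * u" using u powr_add[of u "-1/2" 1] by simp
      ultimately have "- 2 * (- (1/2 * u powr (-1/2)) * B powr (-1/2) + 1/2 * B powr (-3/2) * Y * u powr (1/2)) =
        u powr (-1/2) * B powr (-3/2) * (B - u * Y)" by (simp add: algebra_simps)
      then show ?thesis by (simp add: B_def)
    qed
    finally show "(?F has_real_derivative (1 - s) powr (-1/2) * (1 + (1 - s) * Y) powr (-3/2)) (at s)"
      by (simp add: B_def u_def)
  qed (auto)
  then show ?thesis by simp
qed

lemma poisson_hermite_kernel_nonneg: "0 < t \<Longrightarrow> 0 \<le> poisson_hermite_kernel t x y"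
  unfolding poisson_hermite_kernel_eq
  by (intro mult_nonneg_nonneg Bochner_Integration.integral_nonneg mehler_integrand_nonneg) auto

lemma hermite_weight_eq:
  "hermite_weight y = exp (- (y\<^sup>2 / 2)) * ((1 + \<bar>y\<bar>) powr (-1/2) * ln (exp 1 + \<bar>y\<bar>) powr (-3/2))"
  unfolding hermite_weight_def by (simp add: powr_minus_divide)

lemma ln_exp1_add_ge: "0 \<le> v \<Longrightarrow> 1 \<le> ln (exp 1 + (v::real))"
proof -
  assume "0 \<le> v"
  then have "ln (exp 1) \<le> ln (exp 1 + v)" by (intro ln_mono) auto
  then show ?thesis by simp
qed

text \<open>
  The factors of the weight have separate origins: the Gaussian is the value of the Mehler kernel at
  \<open>s = 1\<close>, the logarithm comes from \<open>kappa s\<close>, and \<open>(1 + \<bar>y\<bar>) powr (-1/2)\<close> from integrating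
  \<open>(1 - s) powr (-1/2)\<close> over \<open>1 - s\<close> of order \<open>1 / \<bar>y\<bar>\<close>.
\<close>
lemma poisson_hermite_kernel_far:
  assumes t: "0 < t" and x: "\<bar>x\<bar> \<le> m" and y: "16 * m \<le> \<bar>y\<bar>" "1 \<le> \<bar>y\<bar>"
  shows "poisson_hermite_kernel t x y \<le> (2048 + 16384 * exp (4 * m\<^sup>2)) * t * hermite_weight y"
proof -
  define Y where "Y = \<bar>y\<bar>"
  define L where "L = ln (exp 1 + Y)"
  define C where "C = 8192 * exp (4 * m\<^sup>2)"
  have Y: "1 \<le> Y" using y by (simp add: Y_def)
  have L: "1 \<le> L" unfolding L_def using Y by (intro ln_exp1_add_ge) auto
  let ?g = "\<lambda>s. exp (- (y\<^sup>2 / 2)) * (512 / Y ^ 4 * indicator {0<..<1} s + C * L powr (-3/2) *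
     (indicator {0<..<1} s * ((1 - s) powr (-1/2) * (1 + (1 - s) * Y) powr (-3/2))))"
  have g: "has_bochner_integral lborel ?g
     (exp (- (y\<^sup>2 / 2)) * (512 / Y ^ 4 * 1 + C * L powr (-3/2) * (2 * (1 + Y) powr (-1/2))))"
  proof (intro has_bochner_integral_mult_right has_bochner_integral_add)
    show "has_bochner_integral lborel (indicator {0<..<1::real}) (1::real)"
      using has_bochner_integral_real_indicator[of "{0<..<1::real}" lborel] by simp
    show "has_bochner_integral lborel (\<lambda>s. indicator {0<..<1} s * ((1 - s) powr (-1/2) *
        (1 + (1 - s) * Y) powr (-3/2))) (2 * (1 + Y) powr (-1/2))"
      using Y by (intro has_bochner_integral_far_profile) auto
  qed
  have "(\<integral>s. indicator {0<..<1} s * mehler_integrand t x y s \<partial>lborel) \<le> (\<integral>s. ?g s \<partial>lborel)"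
  proof (rule integral_mono')
    show "integrable lborel ?g" using g by (simp add: has_bochner_integral_iff)
    fix s :: real
    have C: "0 \<le> C" by (simp add: C_def)
    show "0 \<le> ?g s" using C Y by (auto intro!: mult_nonneg_nonneg add_nonneg_nonneg)
    consider "s \<notin> {0<..<1}" | "0 < s" "s \<le> 1/2" | "1/2 < s" "s < 1" by force
    then show "indicator {0<..<1} s * mehler_integrand t x y s \<le> ?g s"
    proof cases
      case 2
      have "mehler_integrand t x y s \<le> exp (- (y\<^sup>2 / 2)) * (512 / Y ^ 4)"
        unfolding Y_def by (rule mehler_integrand_far_left) (use 2 x y in auto)
      also have "\<dots> \<le> exp (- (y\<^sup>2 / 2)) * (512 / Y ^ 4 + C * L powr (-3/2) *
          ((1 - s) powr (-1/2) * (1 + (1 - s) * Y) powr (-3/2)))"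
        using C by (intro mult_left_mono) (auto intro!: mult_nonneg_nonneg)
      finally show ?thesis using 2 by simp
    next
      case 3
      have "mehler_integrand t x y s \<le> exp (- (y\<^sup>2 / 2)) * (C * L powr (-3/2) *
          ((1 - s) powr (-1/2) * (1 + (1 - s) * Y) powr (-3/2)))"
        unfolding Y_def C_def L_def by (rule mehler_integrand_far_right) (use 3 x in auto)
      also have "\<dots> \<le> exp (- (y\<^sup>2 / 2)) * (512 / Y ^ 4 + C * L powr (-3/2) *
          ((1 - s) powr (-1/2) * (1 + (1 - s) * Y) powr (-3/2)))"
        using Y by (intro mult_left_mono) auto
      finally show ?thesis using 3 by simp
    qed simp
  qed
  also have "\<dots> = exp (- (y\<^sup>2 / 2)) * (512 / Y ^ 4 * 1 + C * L powr (-3/2) * (2 * (1 + Y) powr (-1/2)))"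
    using g by (rule has_bochner_integral_integral_eq)
  also have "\<dots> \<le> exp (- (y\<^sup>2 / 2)) * (2048 * ((1 + Y) powr (-1/2) * L powr (-3/2)) +
      C * L powr (-3/2) * (2 * (1 + Y) powr (-1/2)))"
  proof (intro mult_left_mono add_right_mono)
    have "(1 + Y) powr (1/2) * L powr (3/2) \<le> (1 + Y) powr (1/2) * (1 + Y) powr (3/2)"
      unfolding L_def using Y L ln_exp1_add_le[of Y]
      by (intro mult_left_mono powr_mono2) (auto simp: L_def)
    also have "\<dots> = (1 + Y)\<^sup>2" using Y by (simp add: powr_add[symmetric])
    also have "\<dots> \<le> (2 * Y)\<^sup>2" using Y by (intro power_mono) auto
    also have "\<dots> \<le> 4 * Y ^ 4" using Y power_increasing[of 2 4 Y] by (simp add: power_mult_distrib)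
    finally have P: "(1 + Y) powr (1/2) * L powr (3/2) \<le> 4 * Y ^ 4" .
    have "512 / Y ^ 4 * 1 = 2048 / (4 * Y ^ 4)" by simp
    also have "\<dots> \<le> 2048 / ((1 + Y) powr (1/2) * L powr (3/2))"
      using P Y L by (intro divide_left_mono) (auto intro!: mult_pos_pos)
    also have "\<dots> = 2048 * ((1 + Y) powr (-1/2) * L powr (-3/2))"
      by (simp add: powr_minus_divide)
    finally show "512 / Y ^ 4 * 1 \<le> 2048 * ((1 + Y) powr (-1/2) * L powr (-3/2))" .
  qed auto
  also have "\<dots> = (2048 + 16384 * exp (4 * m\<^sup>2)) * hermite_weight y"
    unfolding hermite_weight_eq C_def L_def Y_def by (simp add: algebra_simps)
  finally have "2 / pi * t * (\<integral>s. indicator {0<..<1} s * mehler_integrand t x y s \<partial>lborel) \<le>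
      1 * t * ((2048 + 16384 * exp (4 * m\<^sup>2)) * hermite_weight y)"
    using t pi_ge_two by (intro mult_mono Bochner_Integration.integral_nonneg)
      (auto simp: mehler_integrand_nonneg)
  then show ?thesis unfolding poisson_hermite_kernel_eq by (simp add: mult_ac)
qed

lemma hermite_weight_pos: "0 < hermite_weight y"
  using ln_exp1_add_ge[of "\<bar>y\<bar>"] unfolding hermite_weight_eq
  by (intro mult_pos_pos) (auto simp: powr_gt_zero)

lemma hermite_weight_antimono: "\<bar>y\<bar> \<le> R \<Longrightarrow> hermite_weight R \<le> hermite_weight y"
proof -
  assume y: "\<bar>y\<bar> \<le> R"
  have "y\<^sup>2 \<le> R\<^sup>2" using y by (metis abs_ge_zero power2_abs power_mono)
  moreover have "(1 + \<bar>R\<bar>) powr (-1/2) \<le> (1 + \<bar>y\<bar>) powr (-1/2)" using y by (intro powr_mono2') auto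
  moreover have "ln (exp 1 + \<bar>R\<bar>) powr (-3/2) \<le> ln (exp 1 + \<bar>y\<bar>) powr (-3/2)"
  proof (intro powr_mono2')
    show "0 < ln (exp 1 + \<bar>y\<bar>)" using ln_exp1_add_ge[of "\<bar>y\<bar>"] by simp
    show "ln (exp 1 + \<bar>y\<bar>) \<le> ln (exp 1 + \<bar>R\<bar>)"
      using y by (intro ln_mono) (auto simp: add_pos_nonneg)
  qed simp
  ultimately show ?thesis unfolding hermite_weight_eq by (intro mult_mono) auto
qed

lemma hermite_weight_measurable [measurable]: "hermite_weight \<in> borel_measurable borel"
  unfolding hermite_weight_def by measurable

text \<open>
  On the bounded interval the weight is bounded below, so the error \<open>C * sqrt t\<close> of the near estimate
  can be written in terms of the weight as well.  Having one bound for all \<open>y\<close> makes the later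
  integration a single step.
\<close>
lemma poisson_hermite_kernel_approx:
  assumes m: "1 \<le> m"
  obtains C where "0 \<le> C"
    "\<And>t x y. 0 < t \<Longrightarrow> t \<le> 1 \<Longrightarrow> \<bar>x\<bar> \<le> m \<Longrightarrow>
       \<bar>poisson_hermite_kernel t x y - indicator {-16 * m<..16 * m} y * poisson_kernel t (x - y)\<bar>
         \<le> C * sqrt t * hermite_weight y"
proof -
  define R where "R = 16 * m"
  define C1 where "C1 = (15 + 16 * R\<^sup>2) / hermite_weight R"
  define C2 where "C2 = 2048 + 16384 * exp (4 * m\<^sup>2)"
  have C: "0 \<le> C1" "0 \<le> C2" using hermite_weight_pos[of R] by (auto simp: C1_def C2_def)
  have w0: "0 \<le> hermite_weight y" for y using hermite_weight_pos[of y] by simp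
  have "\<bar>poisson_hermite_kernel t x y - indicator {-16 * m<..16 * m} y * poisson_kernel t (x - y)\<bar>
         \<le> (C1 + C2) * sqrt t * hermite_weight y"
    if t: "0 < t" "t \<le> 1" and x: "\<bar>x\<bar> \<le> m" for t x y
  proof (cases "y \<in> {-R<..R}")
    case True
    then have "\<bar>y\<bar> \<le> R" by auto
    have "\<bar>poisson_hermite_kernel t x y - poisson_kernel t (x - y)\<bar> \<le> (15 + 16 * R\<^sup>2) * sqrt t"
      using t x m \<open>\<bar>y\<bar> \<le> R\<close> by (intro poisson_hermite_kernel_near) (auto simp: R_def)
    also have "\<dots> = C1 * sqrt t * hermite_weight R"
      using hermite_weight_pos[of R] by (simp add: C1_def)
    also have "\<dots> \<le> (C1 + C2) * sqrt t * hermite_weight y"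
      using t C w0 hermite_weight_antimono[OF \<open>\<bar>y\<bar> \<le> R\<close>] by (intro mult_mono) auto
    finally show ?thesis using True by (simp add: R_def)
  next
    case False
    then have y: "16 * m \<le> \<bar>y\<bar>" by (auto simp: R_def)
    have "sqrt t * sqrt t \<le> sqrt t * 1" using t by (intro mult_left_mono) auto
    then have "t \<le> sqrt t" using t by simp
    have "\<bar>poisson_hermite_kernel t x y\<bar> \<le> C2 * t * hermite_weight y"
      unfolding C2_def using poisson_hermite_kernel_nonneg[of t x y] t x y m
      by (simp add: poisson_hermite_kernel_far)
    also have "\<dots> \<le> (C1 + C2) * sqrt t * hermite_weight y"
      using t C w0 \<open>t \<le> sqrt t\<close> by (intro mult_mono) auto
    finally show ?thesis using False by (simp add: R_def)
  qed
  then show ?thesis using C by (intro that[of "C1 + C2"]) auto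
qed

section \<open>Nontangential limits of Poisson--Hermite integrals\<close>

lemma emeasure_bounded_less_top_of_weight:
  assumes M: "sets M = sets borel" "(\<integral>\<^sup>+y. ennreal (hermite_weight y) \<partial>M) < \<infinity>"
    and A: "A \<in> sets borel" "bounded A"
  shows "emeasure M A < \<infinity>"
proof -
  note [measurable_cong] = M(1)
  obtain R where R: "\<And>y. y \<in> A \<Longrightarrow> \<bar>y\<bar> \<le> R" using A(2) by (auto simp: bounded_iff)
  have "ennreal (hermite_weight R) * emeasure M A = (\<integral>\<^sup>+y. ennreal (hermite_weight R) * indicator A y \<partial>M)"
    using A M by (simp add: nn_integral_cmult_indicator)
  also have "\<dots> \<le> (\<integral>\<^sup>+y. ennreal (hermite_weight y) \<partial>M)"
    using R hermite_weight_antimono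
    by (intro nn_integral_mono) (auto split: split_indicator intro!: ennreal_leI)
  also have "\<dots> < \<infinity>" by fact
  finally show ?thesis
    using hermite_weight_pos[of R] by (auto simp: ennreal_mult_less_top)
qed

lemma poisson_kernel_le: "t > 0 \<Longrightarrow> poisson_kernel t r \<le> 1 / (pi * t)"
proof -
  assume t: "t > 0"
  have "poisson_kernel t r \<le> t / (pi * t\<^sup>2)"
    unfolding poisson_kernel_def using t by (intro divide_left_mono mult_left_mono)
      (auto intro!: mult_pos_pos add_pos_nonneg)
  then show ?thesis using t by (simp add: power2_eq_square)
qed

lemma poisson_hermite_integral_approx:
  assumes M: "sets M = sets borel" "(\<integral>\<^sup>+y. ennreal (hermite_weight y) \<partial>M) < \<infinity>"
    and t: "0 < t" and C: "0 \<le> C"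
    and close: "\<And>y. \<bar>poisson_hermite_kernel t x y - indicator {a<..b} y * poisson_kernel t (x - y)\<bar>
         \<le> C * hermite_weight y"
  shows "\<bar>(\<integral>y. poisson_hermite_kernel t x y \<partial>M) - (\<integral>y. indicator {a<..b} y * poisson_kernel t (x - y) \<partial>M)\<bar>
           \<le> C * (\<integral>y. hermite_weight y \<partial>M)"
proof -
  note [measurable_cong] = M(1)
  let ?K = "poisson_hermite_kernel t x" and ?p = "\<lambda>y. indicator {a<..b} y * poisson_kernel t (x - y)"
  have [measurable]: "?p \<in> borel_measurable borel" unfolding poisson_kernel_def by measurable
  have w: "integrable M hermite_weight"
    using M hermite_weight_pos by (intro integrableI_nonneg) (auto intro: less_imp_le)
  have p: "integrable M ?p"
  proof (rule integrableI_bounded_set[where A = "{a<..b}" and B = "1 / (pi * t)"])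
    show "emeasure M {a<..b} < \<infinity>"
      by (rule emeasure_bounded_less_top_of_weight[OF M]) auto
    show "AE y in M. y \<in> {a<..b} \<longrightarrow> norm (?p y) \<le> 1 / (pi * t)"
      using poisson_kernel_le[OF t] poisson_kernel_nonneg[OF t] by auto
  qed (use M in auto)
  have d: "integrable M (\<lambda>y. ?K y - ?p y)"
  proof (rule Bochner_Integration.integrable_bound)
    show "integrable M (\<lambda>y. C * hermite_weight y)" using w by simp
    show "AE y in M. norm (?K y - ?p y) \<le> norm (C * hermite_weight y)"
      unfolding real_norm_def by (intro AE_I2 order_trans[OF close abs_ge_self])
  qed measurable
  have "integrable M ?K" using Bochner_Integration.integrable_add[OF d p] by simp
  then have "(\<integral>y. ?K y \<partial>M) - (\<integral>y. ?p y \<partial>M) = (\<integral>y. ?K y - ?p y \<partial>M)" using p by simp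
  also have "\<bar>\<dots>\<bar> \<le> (\<integral>y. C * hermite_weight y \<partial>M)"
    using d w close by (intro integral_abs_bound_integral) auto
  finally show ?thesis by simp
qed

lemma nontangential_limit_poisson_hermite_real:
  fixes M N :: "real measure" and F :: "real \<Rightarrow> real"
  assumes M: "sets M = sets borel" "(\<integral>\<^sup>+y. ennreal (hermite_weight y) \<partial>M) < \<infinity>"
    and N: "sets N = sets borel" "(\<integral>\<^sup>+y. ennreal (hermite_weight y) \<partial>N) < \<infinity>"
    and F: "\<And>a b. a < b \<Longrightarrow> measure M {a<..b} - measure N {a<..b} = F b - F a"
    and D: "(F has_real_derivative D) (at x\<^sub>0)" and \<alpha>: "0 < \<alpha>"
  shows "((\<lambda>(t, x). (\<integral>y. poisson_hermite_kernel t x y \<partial>M) - (\<integral>y. poisson_hermite_kernel t x y \<partial>N)) \<longlongrightarrow> D)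
           (at (0, x\<^sub>0) within {(t, x). 0 < t \<and> \<bar>x - x\<^sub>0\<bar> < \<alpha> * t})"
    (is "(?J \<longlongrightarrow> D) ?F")
proof -
  \<comment> \<open>The cone points with \<open>\<bar>x - x\<^sub>0\<bar> < 1\<close> satisfy \<open>\<bar>x\<bar> \<le> m\<close>.\<close>
  define m where "m = \<bar>x\<^sub>0\<bar> + 1"
  have m: "1 \<le> m" by (simp add: m_def)
  obtain C where C: "0 \<le> C"
    "\<And>t x y. 0 < t \<Longrightarrow> t \<le> 1 \<Longrightarrow> \<bar>x\<bar> \<le> m \<Longrightarrow>
       \<bar>poisson_hermite_kernel t x y - indicator {-16 * m<..16 * m} y * poisson_kernel t (x - y)\<bar>
         \<le> C * sqrt t * hermite_weight y"
    using poisson_hermite_kernel_approx[OF m] by metis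
  let ?I = "{-16 * m<..16 * m}"
  define A where "A = (\<lambda>(t, x). (\<integral>y. indicator ?I y * poisson_kernel t (x - y) \<partial>M) -
                   (\<integral>y. indicator ?I y * poisson_kernel t (x - y) \<partial>N))"
  define W where "W = (\<integral>y. hermite_weight y \<partial>M) + (\<integral>y. hermite_weight y \<partial>N)"
  define H where "H = (\<lambda>z. measure M {-16 * m<..z} - measure N {-16 * m<..z})"
  have x0: "-16 * m < x\<^sub>0" "x\<^sub>0 < 16 * m" by (auto simp: m_def)
  have "((\<lambda>z. F z - F (-16 * m)) has_real_derivative D) (at x\<^sub>0)"
    using DERIV_diff[OF D DERIV_const] by simp
  moreover have "\<forall>\<^sub>F z in nhds x\<^sub>0. z \<in> {-16 * m<..}"
    using x0 by (intro eventually_nhds_in_open) auto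
  then have "\<forall>\<^sub>F z in nhds x\<^sub>0. F z - F (-16 * m) = H z"
    by eventually_elim (simp add: H_def F)
  ultimately have H: "(H has_real_derivative D) (at x\<^sub>0)"
    by (simp only: DERIV_cong_ev[OF refl _ refl])
  have A: "(A \<longlongrightarrow> D) ?F"
    unfolding A_def
    by (rule nontangential_limit_poisson_integral[OF M(1) _ N(1) _ x0 \<alpha> H_def H])
       (auto intro!: emeasure_bounded_less_top_of_weight[OF M, unfolded infinity_ennreal_def]
         emeasure_bounded_less_top_of_weight[OF N, unfolded infinity_ennreal_def])
  have tx: "(fst \<longlongrightarrow> 0) ?F" "(snd \<longlongrightarrow> x\<^sub>0) ?F"
    by (auto intro!: tendsto_eq_intros simp: tendsto_fst tendsto_snd)
  have cone: "\<forall>\<^sub>F q in ?F. 0 < fst q"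
    unfolding eventually_at_filter by (auto intro!: always_eventually)
  have "((\<lambda>q. ?J q - A q) \<longlongrightarrow> 0) ?F"
  proof (rule Lim_null_comparison)
    have "((\<lambda>q. C * sqrt (fst q) * W) \<longlongrightarrow> C * sqrt 0 * W) ?F" by (intro tendsto_intros tx)
    then show "((\<lambda>q. C * sqrt (fst q) * W) \<longlongrightarrow> 0) ?F" by simp
    have "\<forall>\<^sub>F q in ?F. fst q < 1" using tx(1) by (rule order_tendstoD) simp
    moreover have "\<forall>\<^sub>F q in ?F. dist (snd q) x\<^sub>0 < 1" using tx(2) by (rule tendstoD) simp
    ultimately show "\<forall>\<^sub>F q in ?F. norm (?J q - A q) \<le> C * sqrt (fst q) * W"
      using cone
    proof eventually_elim
      case (elim q)
      obtain t x where q: "q = (t, x)" by (cases q)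
      have t: "0 < t" "t \<le> 1" and x: "\<bar>x\<bar> \<le> m" using elim by (auto simp: q m_def dist_real_def)
      have c: "0 \<le> C * sqrt t" using C t by simp
      note * = poisson_hermite_integral_approx[OF _ _ t(1) c C(2)[OF t x]]
      show ?case
        using *[OF M] *[OF N] unfolding q A_def W_def case_prod_conv fst_conv real_norm_def distrib_left
        by linarith
    qed
  qed
  from tendsto_add[OF this A] show ?thesis by simp
qed

theorem corollary1p3:
  fixes \<nu> :: "real set \<Rightarrow> complex" and F :: "real \<Rightarrow> complex" and x\<^sub>0 :: real
  assumes "\<nu> \<in> weighted_measures hermite_weight"
    and "is_lebesgue_stieltjes \<nu> F"
    and "F differentiable (at x\<^sub>0)"
  shows "\<forall>\<alpha>>0. ((\<lambda>(t, x). poisson_hermite t \<nu> x) \<longlongrightarrow> vector_derivative F (at x\<^sub>0))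
           (at (0, x\<^sub>0) within {(t, x). 0 < t \<and> \<bar>x - x\<^sub>0\<bar> < \<alpha> * t})"
proof (intro allI impI)
  fix \<alpha> :: real assume \<alpha>: "0 < \<alpha>"
  let ?F = "at (0, x\<^sub>0) within {(t, x). 0 < t \<and> \<bar>x - x\<^sub>0\<bar> < \<alpha> * t}"
  let ?P = positive_variation and ?K = poisson_hermite_kernel
  define v where "v = vector_derivative F (at x\<^sub>0)"
  have v: "(F has_vector_derivative v) (at x\<^sub>0)"
    using assms(3) unfolding v_def by (simp add: vector_derivative_works)
  have \<nu>: "locally_finite_complex_measure \<nu>"
    and fin: "(\<integral>\<^sup>+y. ennreal (hermite_weight y) \<partial>total_variation \<nu>) < \<infinity>"
    using assms(1) by (auto simp: weighted_measures_def)
  \<comment> \<open>The functional \<open>f\<close> stands for \<open>Re\<close> and \<open>Im\<close>.\<close>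
  have component: "((\<lambda>(t, x). (\<integral>y. ?K t x y \<partial>?P (\<lambda>A. f (\<nu> A))) -
      (\<integral>y. ?K t x y \<partial>?P (\<lambda>A. - f (\<nu> A)))) \<longlongrightarrow> f v) ?F"
    if f: "bounded_linear f" and lf: "locally_finite_signed_measure (\<lambda>A. f (\<nu> A))"
      and le: "\<And>z. \<bar>f z\<bar> \<le> cmod z" for f :: "complex \<Rightarrow> real"
  proof (rule nontangential_limit_poisson_hermite_real[OF _ _ _ _ _ _ \<alpha>, where F = "\<lambda>z. f (F z)"])
    note lf' = locally_finite_signed_measure_uminus[OF lf]
    have mono: "(\<integral>\<^sup>+y. ennreal (hermite_weight y) \<partial>?P \<mu>) < \<infinity>" if "?P \<mu> \<le> total_variation \<nu>" for \<mu>
      by (rule le_less_trans[OF nn_integral_mono_measure fin]) (use that in simp_all)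
    have "?P (\<lambda>A. f (\<nu> A)) \<le> total_variation \<nu>" "?P (\<lambda>A. - f (\<nu> A)) \<le> total_variation \<nu>"
      using le by (auto intro!: positive_variation_le_total_variation \<nu> lf lf' simp: abs_le_iff)
    then show w: "(\<integral>\<^sup>+y. ennreal (hermite_weight y) \<partial>?P (\<lambda>A. f (\<nu> A))) < \<infinity>"
      "(\<integral>\<^sup>+y. ennreal (hermite_weight y) \<partial>?P (\<lambda>A. - f (\<nu> A))) < \<infinity>"
      by (auto intro: mono[unfolded infinity_ennreal_def])
    show "measure (?P (\<lambda>A. f (\<nu> A))) {a<..b} - measure (?P (\<lambda>A. - f (\<nu> A))) {a<..b} = f (F b) - f (F a)"
      if "a < b" for a b
    proof -
      have "f (\<nu> {a<..b}) = measure (?P (\<lambda>A. f (\<nu> A))) {a<..b} - measure (?P (\<lambda>A. - f (\<nu> A))) {a<..b}"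
        by (rule jordan_decomposition[OF lf])
           (use w in \<open>auto intro!: emeasure_bounded_less_top_of_weight[unfolded infinity_ennreal_def]\<close>)
      moreover have "\<nu> {a<..b} = F b - F a"
        using assms(2) that by (simp add: is_lebesgue_stieltjes_def)
      ultimately show ?thesis using linear_diff[OF bounded_linear.linear[OF f]] by simp
    qed
    show "((\<lambda>z. f (F z)) has_real_derivative f v) (at x\<^sub>0)"
      using bounded_linear.has_vector_derivative[OF f v]
      by (simp add: has_real_derivative_iff_has_vector_derivative)
  qed auto
  have "((\<lambda>q. complex_of_real (case q of (t, x) \<Rightarrow>
            (\<integral>y. ?K t x y \<partial>?P (\<lambda>A. Re (\<nu> A))) - (\<integral>y. ?K t x y \<partial>?P (\<lambda>A. - Re (\<nu> A)))) +
          \<i> * complex_of_real (case q of (t, x) \<Rightarrow>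
            (\<integral>y. ?K t x y \<partial>?P (\<lambda>A. Im (\<nu> A))) - (\<integral>y. ?K t x y \<partial>?P (\<lambda>A. - Im (\<nu> A)))))
         \<longlongrightarrow> complex_of_real (Re v) + \<i> * complex_of_real (Im v)) ?F"
    using \<nu> unfolding locally_finite_complex_measure_def
    by (intro tendsto_intros component bounded_linear_Re bounded_linear_Im abs_Re_le_cmod abs_Im_le_cmod) auto
  moreover have "complex_of_real (Re v) + \<i> * complex_of_real (Im v) = v"
    by (simp add: complex_eq[symmetric])
  ultimately show "((\<lambda>(t, x). poisson_hermite t \<nu> x) \<longlongrightarrow> vector_derivative F (at x\<^sub>0)) ?F"
    unfolding v_def[symmetric] poisson_hermite_def complex_measure_integral_def signed_integral_def
    by (simp add: case_prod_unfold)
qed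

end
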